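(* Let $\mu$ be a positive $\sigma$-finite Borel measure on $\mathbb{S}^2$, let $\Omega\subset\mathbb{S}^2$ be measurable, let $L\in\{1,2,\ldots\}$ and let $t_{L,L}\le\delta<1$. Then for every $f\in\mathcal{S}_L$, $$\int_{\mathbb{S}^2}|f|^2\,d\mu\;\le\;\left(2\pi\int_\delta^1 P_L(t)^2\,dt\right)^{-1}\cdot\|f\|_{L^2(\mathbb{S}^2)}^2\cdot\sup_{y\in\mathbb{S}^2}\mu(\mathcal{C}_\delta(y)).$$ Consequently, $$\lambda^2_{\mathcal{S}_L}(\Omega)\;\le\; B_L\cdot\rho(\Omega,L),\qquad\text{where}\qquad B_L:=(1-t_{L,L})\left(\int_{t_{L,L}}^1P_L(t)^2\,dt\right)^{-1}.$$
   Context: $\mathbb{S}^2$ is the unit sphere in $\mathbb{R}^3$ with the rotation invariant surface measure $\sigma$ (total mass $4\pi$); $|A|=\sigma(A)$ for measurable $A\subset\mathbb{S}^2$, and $L^p(\mathbb{S}^2)$ is taken with respect to $\sigma$. $P_l$ denotes the Legendre polynomial of degree $l$, normalized by $P_l(1)=1$; for $L\ge1$, $t_{L,L}$ is the largest zero of $P_L$. Let $Y_l^m$, $|m|\le l$, $l=0,1,\ldots$, be the standard spherical harmonics, orthonormal in $L^2(\mathbb{S}^2)$: in spherical coordinates (polar angle $\theta$, azimuth $\varphi$), $Y_l^m(\theta,\varphi)=\sqrt{\frac{2l+1}{4\pi}\frac{(l-m)!}{(l+m)!}}\,P_l^m(\cos\theta)e^{im\varphi}$, where $P_l^m(t)=\frac{(-1)^{m+l}}{2^l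 l!}(1-t^2)^{m/2}\frac{d^{m+l}}{dt^{m+l}}(1-t^2)^l$. $\mathcal{S}_L$ is the complex linear span of $\{Y_l^m: 0\le l\le L,\ |m|\le l\}$. For $\delta\in[-1,1]$ and $x\in\mathbb{S}^2$, the spherical cap is $\mathcal{C}_\delta(x)=\{y\in\mathbb{S}^2:\langle x,y\rangle\ge\delta\}$. The concentration constant is $\lambda^2_{\mathcal{S}_L}(\Omega)=\sup_{f\in\mathcal{S}_L\setminus\{0\}}\frac{\int_\Omega|f|^2d\sigma}{\int_{\mathbb{S}^2}|f|^2d\sigma}$, and the maximum Nyquist density is $\rho(\Omega,L)=\sup_{y\in\mathbb{S}^2}\frac{|\Omega\cap\mathcal{C}_{t_{L,L}}(y)|}{|\mathcal{C}_{t_{L,L}}(y)|}$. The convention $0\cdot\infty=0$ is used. *)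

theory Defs
  imports "HOL-Analysis.Analysis"
begin

section \<open>Surface measure on the unit sphere\<close>

text \<open>
  The surface measure is introduced as a cone measure: a Borel set \<open>A\<close> of unit vectors gets
  three times the volume of \<open>{t x | 0 < t \<le> 1, x \<in> A}\<close>. The lemmas below confirm that it is the
  rotation invariant measure of total mass \<open>4 \<pi>\<close>.
\<close>

definition sphere_borel_measure :: "(real^3) measure" where
  "sphere_borel_measure =
     scale_measure 3
       (distr (restrict_space lborel (cball 0 1 - {0}))
              (restrict_space borel (sphere 0 1))
              (\<lambda>x. x /\<^sub>R norm x))"

text \<open>
  As with \<^const>\<open>lborel\<close> and \<^const>\<open>lebesgue\<close>, the surface measure itself is the completion, so
  that every Lebesgue measurable subset of the sphere is measurable.
\<close>

definition sphere_measure :: "(real^3) measure" where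
  "sphere_measure = completion sphere_borel_measure"

lemma space_sphere_borel_measure [simp]: "space sphere_borel_measure = sphere 0 1"
  by (simp add: sphere_borel_measure_def space_restrict_space space_scale_measure)

lemma sets_sphere_borel_measure [simp, measurable_cong]:
  "sets sphere_borel_measure = sets (restrict_space borel (sphere 0 1))"
  by (simp add: sphere_borel_measure_def sets_scale_measure)

lemma space_sphere_measure [simp]: "space sphere_measure = sphere 0 1"
  by (simp add: sphere_measure_def)

lemma measurable_radial_projection:
  "(\<lambda>x::real^3. x /\<^sub>R norm x)
     \<in> restrict_space lborel (cball 0 1 - {0}) \<rightarrow>\<^sub>M restrict_space borel (sphere 0 1)"
  by (rule measurable_restrict_space3) (auto, measurable)

lemma emeasure_sphere_borel_measure:
  assumes "A \<in> sets (restrict_space borel (sphere 0 1))"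
  shows "emeasure sphere_borel_measure A
           = 3 * emeasure lborel {x \<in> cball 0 1 - {0}. x /\<^sub>R norm x \<in> A}"
proof -
  have "(\<lambda>x. x /\<^sub>R norm x) -` A \<inter> space (restrict_space lborel (cball 0 1 - {0}))
          = {x \<in> cball 0 1 - {0}. x /\<^sub>R norm x \<in> A}"
    by (auto simp: space_restrict_space)
  moreover have "{x \<in> cball 0 1 - {0}. x /\<^sub>R norm x \<in> A} \<subseteq> cball 0 1 - {0}"
    by auto
  ultimately show ?thesis
    unfolding sphere_borel_measure_def
    using assms measurable_radial_projection
    by (simp add: emeasure_distr emeasure_restrict_space)
qed

lemma emeasure_sphere_measure_sphere:
  "emeasure sphere_measure (sphere 0 1) = ennreal (4 * pi)"
proof -
  have S: "sphere 0 1 \<in> sets (restrict_space borel (sphere (0::real^3) 1))"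
    using sets.top[of "restrict_space borel (sphere (0::real^3) 1)"]
    by (simp add: space_restrict_space)
  have "{x \<in> cball 0 1 - {0}. x /\<^sub>R norm x \<in> sphere 0 1} = cball (0::real^3) 1 - {0}"
    by auto
  moreover have "emeasure lborel (cball (0::real^3) 1 - {0}) = emeasure lborel (cball (0::real^3) 1)"
    by (rule emeasure_Diff_null_set) auto
  moreover have "emeasure lborel (cball (0::real^3) 1) = ennreal (4 / 3 * pi)"
    by (simp add: emeasure_cball unit_ball_vol_3)
  ultimately have "emeasure sphere_borel_measure (sphere 0 1) = 3 * ennreal (4 / 3 * pi)"
    using emeasure_sphere_borel_measure[OF S] by simp
  also have "\<dots> = ennreal (3 * (4 / 3 * pi))"
    by (subst ennreal_mult) auto
  finally show ?thesis
    using S by (simp add: sphere_measure_def)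
qed

lemma emeasure_lborel_orthogonal_vimage:
  fixes T :: "real^3 \<Rightarrow> real^3"
  assumes T: "orthogonal_transformation T" and A: "A \<in> sets borel"
  shows "emeasure lborel (T -` A) = emeasure lborel A"
proof -
  have meas: "T \<in> borel_measurable borel"
    using orthogonal_transformation_linear[OF T]
    by (intro borel_measurable_continuous_onI linear_continuous_on)
       (simp add: linear_conv_bounded_linear)
  have "lborel = distr lborel borel T"
  proof (rule lborel_eqI)
    fix l u :: "real^3"
    assume le: "\<And>b. b \<in> Basis \<Longrightarrow> l \<bullet> b \<le> u \<bullet> b"
    have invT: "orthogonal_transformation (inv T)"
      by (rule orthogonal_transformation_inv[OF T])
    have bij: "bij T" by (rule orthogonal_transformation_bij[OF T])
    have img: "T -` box l u = inv T ` box l u"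
      by (rule bij_vimage_eq_inv_image[OF bij])
    have "emeasure lborel (T -` box l u) = emeasure lebesgue (T -` box l u)"
      using measurable_sets[OF meas, of "box l u"] by simp
    also have "\<dots> = ennreal (measure lebesgue (T -` box l u))"
      unfolding img using measurable_orthogonal_image[OF invT, of "box l u"]
      by (intro emeasure_eq_measure2) auto
    also have "\<dots> = ennreal (measure lebesgue (box l u))"
      unfolding img by (subst measure_orthogonal_image[OF invT]) auto
    also have "\<dots> = (\<Prod>b\<in>Basis. (u - l) \<bullet> b)"
      using le by (simp add: measure_def)
    finally show "emeasure (distr lborel borel T) (box l u) = (\<Prod>b\<in>Basis. (u - l) \<bullet> b)"
      using meas by (simp add: emeasure_distr)
  qed simp
  then have "emeasure lborel A = emeasure (distr lborel borel T) A" by simp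
  also have "\<dots> = emeasure lborel (T -` A)"
    using meas A by (simp add: emeasure_distr)
  finally show ?thesis by simp
qed

lemma sphere_borel_measure_rotation_invariant:
  assumes T: "orthogonal_transformation T"
    and A: "A \<in> sets (restrict_space borel (sphere (0::real^3) 1))"
  shows "emeasure sphere_borel_measure (T -` A) = emeasure sphere_borel_measure A"
proof -
  have AB: "A \<in> sets borel" "A \<subseteq> sphere 0 1"
    using A by (auto simp: sets_restrict_space_iff)
  have lin: "linear T" and nrm: "\<And>x. norm (T x) = norm x"
    using T by (auto simp: orthogonal_transformation)
  have meas: "T \<in> borel_measurable borel"
    using lin by (intro borel_measurable_continuous_onI linear_continuous_on)
       (simp add: linear_conv_bounded_linear)
  have TA: "T -` A \<in> sets (restrict_space borel (sphere 0 1))"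
    using AB measurable_sets[OF meas AB(1)] nrm
    by (fastforce simp: sets_restrict_space_iff)
  have T0: "T x = 0 \<longleftrightarrow> x = 0" for x
    using nrm[of x] by (metis norm_eq_zero)
  let ?C = "\<lambda>A. {x \<in> cball (0::real^3) 1 - {0}. x /\<^sub>R norm x \<in> A}"
  have "?C (T -` A) = T -` ?C A"
    using lin by (auto simp: nrm T0 linear_cmul)
  moreover have "?C A \<in> sets borel"
    using AB by measurable
  ultimately show ?thesis
    by (simp only: emeasure_sphere_borel_measure[OF A] emeasure_sphere_borel_measure[OF TA]
        emeasure_lborel_orthogonal_vimage[OF T])
qed

definition sphere_L2_norm :: "(real^3 \<Rightarrow> complex) \<Rightarrow> real" where
  "sphere_L2_norm f = sqrt (LINT x|sphere_measure. (cmod (f x))\<^sup>2)"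

definition spherical_cap :: "real \<Rightarrow> real^3 \<Rightarrow> (real^3) set" where
  "spherical_cap \<delta> x = {y \<in> sphere 0 1. x \<bullet> y \<ge> \<delta>}"


section \<open>Legendre polynomials and spherical harmonics\<close>

definition legendre :: "nat \<Rightarrow> real poly" where
  "legendre l = smult (1 / (2 ^ l * fact l)) ((pderiv ^^ l) ([:-1, 0, 1:] ^ l))"

lemma poly_legendre_1: "poly (legendre l) 1 = 1"
proof -
  have *: "poly ((pderiv ^^ n) ([:-1, 1:] ^ n * q)) 1 = fact n * poly q 1" for n and q :: "real poly"
  proof (induction n arbitrary: q)
    case (Suc n)
    have "pderiv ([:-1, 1:] ^ Suc n * q)
            = [:-1, 1:] ^ n * (smult (real (Suc n)) q + [:-1, 1:] * pderiv q)"
      by (simp only: pderiv_mult pderiv_power_Suc) (simp add: pderiv_pCons algebra_simps)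
    then have "(pderiv ^^ Suc n) ([:-1, 1:] ^ Suc n * q)
            = (pderiv ^^ n) ([:-1, 1:] ^ n * (smult (real (Suc n)) q + [:-1, 1:] * pderiv q))"
      by (simp only: funpow_Suc_right o_apply)
    then show ?case
      by (simp only: Suc.IH) simp
  qed simp
  have "[:-1, 0, 1:] = [:-1, 1:] * ([:1, 1:] :: real poly)" by simp
  then have "[:-1, 0, 1:] ^ l = [:-1, 1:] ^ l * ([:1, 1:] :: real poly) ^ l"
    by (simp only: power_mult_distrib)
  then show ?thesis
    by (simp only: legendre_def poly_smult *) simp
qed

definition legendre_largest_zero :: "nat \<Rightarrow> real" where
  "legendre_largest_zero L = Max {t. poly (legendre L) t = 0}"

text \<open>
  For \<open>\<bar>m\<bar> \<le> l\<close>. The factor \<open>(1 - t\<^sup>2)\<^bsup>m/2\<^esup>\<close> is an integer power of the square root, as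
  \<^term>\<open>0 powr 0 = (0::real)\<close> would give the wrong value at \<open>t = \<plusminus>1\<close> when \<open>m = 0\<close>. For \<open>m \<noteq> 0\<close>
  the value at \<open>t = \<plusminus>1\<close> is \<open>0\<close>, the continuous extension, also when \<open>m < 0\<close>.
\<close>

definition assoc_legendre :: "nat \<Rightarrow> int \<Rightarrow> real \<Rightarrow> real" where
  "assoc_legendre l m t =
     (-1) ^ nat (m + int l) / (2 ^ l * fact l) * sqrt (1 - t\<^sup>2) powi m
       * poly ((pderiv ^^ nat (m + int l)) ([:1, 0, -1:] ^ l)) t"

text \<open>
  Spherical harmonics are functions of a unit vector \<open>x\<close> with \<open>cos \<theta> = x $ 3\<close> and azimuth
  \<open>\<phi> = Arg (x $ 1 + \<i> x $ 2)\<close>. At the poles the choice of \<open>\<phi>\<close> does not matter.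
\<close>

definition spherical_harmonic :: "nat \<Rightarrow> int \<Rightarrow> real^3 \<Rightarrow> complex" where
  "spherical_harmonic l m x =
     complex_of_real
       (sqrt ((2 * real l + 1) / (4 * pi) * (fact (nat (int l - m)) / fact (nat (int l + m))))
          * assoc_legendre l m (x $ 3))
     * exp (\<i> * of_int m * of_real (Arg (Complex (x $ 1) (x $ 2))))"

text \<open>
  Elements are total functions of which only the restriction to the sphere is constrained; all
  notions below depend on that restriction only.
\<close>

definition spherical_polys :: "nat \<Rightarrow> (real^3 \<Rightarrow> complex) set" where
  "spherical_polys L =
     {f. \<exists>c :: nat \<Rightarrow> int \<Rightarrow> complex. \<forall>x\<in>sphere 0 1.
           f x = (\<Sum>l\<le>L. \<Sum>m\<in>{- int l..int l}. c l m * spherical_harmonic l m x)}"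


section \<open>Concentration constant and maximum Nyquist density\<close>

definition concentration :: "(real^3 \<Rightarrow> complex) set \<Rightarrow> (real^3) set \<Rightarrow> real" where
  "concentration S \<Omega> =
     (SUP f\<in>{f \<in> S. \<exists>x\<in>sphere 0 1. f x \<noteq> 0}.
        (LINT x:\<Omega>|sphere_measure. (cmod (f x))\<^sup>2) / (LINT x|sphere_measure. (cmod (f x))\<^sup>2))"

definition nyquist_density :: "(real^3) set \<Rightarrow> nat \<Rightarrow> real" where
  "nyquist_density \<Omega> L =
     (SUP y\<in>sphere 0 1.
        measure sphere_measure (\<Omega> \<inter> spherical_cap (legendre_largest_zero L) y)
          / measure sphere_measure (spherical_cap (legendre_largest_zero L) y))"

definition sieve_constant :: "nat \<Rightarrow> real" where
  "sieve_constant L =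
     (1 - legendre_largest_zero L)
       * inverse (integral {legendre_largest_zero L..1} (\<lambda>t. (poly (legendre L) t)\<^sup>2))"

end

theory Submission
  imports Defs
begin

text \<open>
  The inequality is a large sieve: a function $f$ of degree at most $L$ is reproduced from its
  values on the caps $C_\<delta>(x)$, and duality then turns mass on caps into mass for $\<mu>$.

  Take the zonal kernel $h(\<langle>x, y\<rangle>)$ with $h = P_L$ on $[\<delta>, 1]$ and $h = 0$ elsewhere.
  By the Funk--Hecke formula (\<open>funk_hecke\<close>) the integral operator $T$ with this kernel multiplies
  harmonics of degree $l$ by $\<kappa>_l = 2\<pi> \int_\<delta>^1 P_L P_l$. Between the largest zero of $P_L$
  and $1$ the Legendre polynomials satisfy $P_0 > P_1 > \ldots > P_L > 0$ (\<open>legendre_strict_decreasing\<close>), so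
  $\<kappa>_0 > \ldots > \<kappa>_L > 0$. Three consequences follow.

    \<^item> $T$ is invertible on the functions of degree at most $L$: if $f = \sum_l F_l$ with $F_l$ of
      degree $l$, then $f = T g$ for $g = \sum_l F_l / \<kappa>_l$.
    \<^item> $T$ is symmetric and its eigenvalues are distinct, so the $F_l$ are pairwise orthogonal. Hence
      $\|g\|^2 = \sum_l \|F_l\|^2 / \<kappa>_l^2 \<le> \|f\|^2 / \<kappa>_L^2$.
    \<^item> By Cauchy--Schwarz, $|f(x)|^2 \<le> \|h\|^2 \int_{\<langle>x, y\<rangle> \<ge> \<delta>} |g(y)|^2 d\<sigma>(y)$, where
      $\|h\|^2 = 2\<pi> \int_\<delta>^1 P_L^2 = \<kappa>_L$.

  Integrating the last bound against $\<mu>$ and exchanging the integrals gives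
  $\int |f|^2 d\<mu> \<le> \<kappa>_L \|g\|^2 \sup_y \<mu>(C_\<delta>(y)) \<le> \<kappa>_L^{-1} \|f\|^2 \sup_y \<mu>(C_\<delta>(y))$, which is
  the claim (\<open>zonal_large_sieve\<close>). The bound for the concentration constant is the case where $\<mu>$ is
  the surface measure restricted to $\<Omega>$ and $\<delta>$ is the largest zero, since caps have area
  $2\<pi>(1 - \<delta>)$.

  The Funk--Hecke formula rests on isotropic vectors. Every spherical harmonic of degree $l$ is a
  linear combination of powers $\<langle>a, x\<rangle>^l$ with $a \<in> \<complex>^3$ and $\<langle>a, a\<rangle> = 0$ (bilinear product), and this
  set of functions is stable under rotations. So one may move $x$ to the north pole and average over
  rotations about the axis, and the average of $\<langle>a, y\<rangle>^l$ is $P_l(y_3)$ times its value at the pole.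
  Both this average and the passage from the $Y_l^m$ to the powers come down to reading off
  coefficients of powers of a quadratic polynomial, which Rodrigues' formula expresses by derivatives
  of $(t^2 - 1)^l$. The integrals over heights are computed by Archimedes' theorem that the height
  of a uniform random point of the sphere is uniform (\<open>distr_sigma_height\<close>).
\<close>

section \<open>Legendre polynomials beyond their largest zero\<close>

lemma higher_pderiv_X_mult:
  "(pderiv ^^ Suc n) ([:0, 1:] * p)
     = [:0, 1:] * (pderiv ^^ Suc n) p + smult (of_nat (Suc n)) ((pderiv ^^ n) p)"
  for p :: "real poly"
proof (induction n)
  case 0
  show ?case by (simp add: pderiv_mult pderiv_pCons)
next
  case (Suc n)
  have "(pderiv ^^ Suc (Suc n)) ([:0, 1:] * p) = pderiv ((pderiv ^^ Suc n) ([:0, 1:] * p))"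
    by simp
  also have "\<dots> = [:0, 1:] * (pderiv ^^ Suc (Suc n)) p + smult (of_nat (Suc (Suc n))) ((pderiv ^^ Suc n) p)"
    unfolding Suc.IH
    by (simp add: pderiv_mult pderiv_pCons pderiv_smult pderiv_add)
       (simp add: smult_add_left numeral_poly)
  finally show ?case .
qed

lemma pderiv_rodrigues_power:
  "pderiv ([:-1, 0, 1:] ^ Suc n)
     = smult (2 * real (Suc n)) ([:0, 1:] * [:-1, 0, 1:] ^ n)"
  by (simp only: pderiv_power_Suc) (simp add: pderiv_pCons algebra_simps smult_add_left)

lemma pderiv2_rodrigues_power:
  "pderiv (pderiv ([:-1, 0, 1:] ^ Suc (Suc n)))
     = smult (2 * real (n + 2) * (2 * real n + 3)) ([:-1, 0, 1:] ^ Suc n)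
       + smult (4 * real (n + 2) * real (n + 1)) ([:-1, 0, 1:] ^ n)"
proof -
  have X2: "[:0, 1:] * [:0, 1:] = [:-1, 0, 1:] + (1 :: real poly)"
    by (simp add: one_pCons)
  have "pderiv (pderiv ([:-1, 0, 1:] ^ Suc (Suc n)))
      = smult (2 * real (n + 2)) ([:-1, 0, 1:] ^ Suc n
          + [:0, 1:] * smult (2 * real (Suc n)) ([:0, 1:] * [:-1, 0, 1:] ^ n))"
    by (simp only: pderiv_rodrigues_power pderiv_smult pderiv_mult)
       (simp add: pderiv_pCons add.commute del: power_Suc)
  also have "[:0, 1:] * smult (2 * real (Suc n)) ([:0, 1:] * [:-1, 0, 1:] ^ n)
      = smult (2 * real (Suc n)) (([:0, 1:] * [:0, 1:]) * [:-1, 0, 1:] ^ n)"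
    by (simp only: mult_smult_right mult.assoc)
  also have "\<dots> = smult (2 * real (Suc n)) ([:-1, 0, 1:] ^ Suc n + [:-1, 0, 1:] ^ n)"
    unfolding X2 by (simp only: distrib_right power_Suc mult_1)
  finally show ?thesis
    by (simp only: smult_add_right smult_smult add.assoc[symmetric] smult_add_left[symmetric])
       (simp add: algebra_simps flip: smult_add_left)
qed

lemma legendre_0 [simp]: "legendre 0 = 1"
  by (simp add: legendre_def)

lemma legendre_1 [simp]: "legendre (Suc 0) = [:0, 1:]"
  by (simp add: legendre_def pderiv_pCons)

text \<open>
  With $Q = X^2 - 1$ and $S = D^n Q^{n+1} / (2^{n+1} (n+1)!)$, an antiderivative of $P_{n+1}$, applying
  the product rule to one derivative of $Q^{n+2}$ gives $P_{n+2} = X P_{n+1} + (n+1) S$, and applying it to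
  two derivatives gives $P_{n+2} = (2n+3) S + P_n$. Eliminating $S$ leaves the recurrence.
\<close>

lemma legendre_recurrence:
  "real (n + 2) * poly (legendre (Suc (Suc n))) t
     = (2 * real n + 3) * t * poly (legendre (Suc n)) t - real (n + 1) * poly (legendre n) t"
proof -
  define S :: "real poly" where "S = smult (1 / (2 ^ Suc n * fact (Suc n))) ((pderiv ^^ n) ([:-1, 0, 1:] ^ Suc n))"
  have a: "legendre (Suc (Suc n)) = [:0, 1:] * legendre (Suc n) + smult (real (Suc n)) S"
  proof -
    have "(pderiv ^^ Suc (Suc n)) ([:-1, 0, 1:] ^ Suc (Suc n))
       = smult (2 * real (n + 2)) ([:0, 1:] * (pderiv ^^ Suc n) ([:-1, 0, 1:] ^ Suc n)
           + smult (real (Suc n)) ((pderiv ^^ n) ([:-1, 0, 1:] ^ Suc n)))"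
      by (subst funpow_Suc_right)
         (simp only: o_apply pderiv_rodrigues_power higher_pderiv_smult higher_pderiv_X_mult,
          simp only: Suc_eq_plus1 add.assoc one_add_one)
    moreover have "1 / (2 ^ Suc (Suc n) * fact (Suc (Suc n))) * (2 * real (n + 2))
        = 1 / (2 ^ Suc n * fact (Suc n))"
      by (simp add: divide_simps)
    moreover from this have "1 / (2 ^ Suc (Suc n) * fact (Suc (Suc n))) * (2 * real (n + 2) * real (Suc n))
        = real (Suc n) * (1 / (2 ^ Suc n * fact (Suc n)))"
      by (metis mult.assoc mult.commute)
    ultimately show ?thesis
      unfolding legendre_def S_def
      by (simp only: smult_smult smult_add_right mult_smult_right)
  qed
  have b: "legendre (Suc (Suc n)) = smult (2 * real n + 3) S + legendre n"
  proof -
    have "(pderiv ^^ Suc (Suc n)) ([:-1, 0, 1:] ^ Suc (Suc n))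
       = smult (2 * real (n + 2) * (2 * real n + 3)) ((pderiv ^^ n) ([:-1, 0, 1:] ^ Suc n))
         + smult (4 * real (n + 2) * real (n + 1)) ((pderiv ^^ n) ([:-1, 0, 1:] ^ n))"
      by (simp only: funpow_Suc_right o_apply pderiv2_rodrigues_power higher_pderiv_add
          higher_pderiv_smult)
    moreover have "1 / (2 ^ Suc (Suc n) * fact (Suc (Suc n))) * (2 * real (n + 2) * (2 * real n + 3))
        = (2 * real n + 3) * (1 / (2 ^ Suc n * fact (Suc n)))"
      by (simp add: divide_simps) (simp add: algebra_simps)
    moreover have "1 / (2 ^ Suc (Suc n) * fact (Suc (Suc n))) * (4 * real (n + 2) * real (n + 1))
        = 1 / (2 ^ n * fact n)"
      by (simp add: divide_simps)
    ultimately show ?thesis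
      unfolding legendre_def S_def
      by (simp only: smult_smult smult_add_right)
  qed
  have "poly (legendre (Suc (Suc n))) t = t * poly (legendre (Suc n)) t + real (Suc n) * poly S t"
    by (subst a) simp
  moreover have "poly (legendre (Suc (Suc n))) t = (2 * real n + 3) * poly S t + poly (legendre n) t"
    by (subst b) simp
  ultimately have "(2 * real n + 3) * poly (legendre (Suc (Suc n))) t - real (Suc n) * poly (legendre (Suc (Suc n))) t
     = (2 * real n + 3) * (t * poly (legendre (Suc n)) t) - real (Suc n) * poly (legendre n) t"
    by algebra
  then show ?thesis
    by (simp add: algebra_simps)
qed

lemma legendre_nonzero: "legendre n \<noteq> 0"
  using poly_legendre_1[of n] by auto

lemma finite_legendre_zeros: "finite {t. poly (legendre n) t = 0}"
  by (rule poly_roots_finite[OF legendre_nonzero])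

text \<open>
  Excludes zeros in $[1, \<infinity>)$: for $t \<ge> 1$ the recurrence propagates $P_{n+1}(t) \<ge> P_n(t)$.
\<close>

lemma legendre_ge_1:
  assumes "t \<ge> 1"
  shows "poly (legendre n) t \<ge> 1 \<and> poly (legendre (Suc n)) t \<ge> poly (legendre n) t"
proof (induction n)
  case 0
  show ?case using assms by simp
next
  case (Suc n)
  let ?p = "\<lambda>n. poly (legendre n) t"
  have "(2 * real n + 3) * ?p (Suc n) \<le> (2 * real n + 3) * t * ?p (Suc n)"
    using Suc assms by (intro mult_right_mono) auto
  moreover have "real (n + 1) * ?p n \<le> real (n + 1) * ?p (Suc n)"
    using Suc by (intro mult_left_mono) auto
  ultimately have "real (n + 2) * ?p (Suc n) \<le> real (n + 2) * ?p (Suc (Suc n))"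
    unfolding legendre_recurrence by (simp add: algebra_simps)
  then have "?p (Suc n) \<le> ?p (Suc (Suc n))"
    by (rule mult_left_le_imp_le) simp
  then show ?case using Suc by linarith
qed

lemma legendre_pos_beyond:
  assumes "\<And>t. t > s \<Longrightarrow> poly (legendre n) t \<noteq> 0" and "t > s"
  shows "poly (legendre n) t > 0"
proof (cases "t \<ge> 1")
  case True
  then show ?thesis using legendre_ge_1[of t n] by linarith
next
  case False
  show ?thesis
  proof (rule ccontr)
    assume "\<not> ?thesis"
    then have "poly (legendre n) t < 0" using assms(1)[OF \<open>t > s\<close>] by force
    then obtain x where "t < x" "poly (legendre n) x = 0"
      using poly_IVT_pos[of t 1 "legendre n"] False by (auto simp: poly_legendre_1)
    then show False using assms(1)[of x] \<open>t > s\<close> by auto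
  qed
qed

text \<open>
  At the largest zero $s$ of $P_{n+1}$ the recurrence reads $(n+2) P_{n+2}(s) = -(n+1) P_n(s)$, and
  $P_n(s) > 0$ as $s$ lies beyond the largest zero of $P_n$. So $P_{n+2}$ is negative at $s$ and $1$ at
  $1$, and its largest zero lies to the right of $s$. Positivity of all lower degrees beyond the
  largest zero is carried along in the induction.
\<close>

lemma legendre_largest_zero_interlacing:
  "poly (legendre (Suc n)) (legendre_largest_zero (Suc n)) = 0 \<and>
   (\<forall>k\<le>Suc n. \<forall>t>legendre_largest_zero (Suc n). poly (legendre k) t > 0) \<and>
   poly (legendre n) (legendre_largest_zero (Suc n)) > 0 \<and>
   0 \<le> legendre_largest_zero (Suc n) \<and> legendre_largest_zero (Suc n) < 1"
proof (induction n)
  case 0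
  have "{t. poly (legendre (Suc 0)) t = 0} = {0}" by auto
  then have "legendre_largest_zero (Suc 0) = 0"
    unfolding legendre_largest_zero_def by simp
  then show ?case by (auto simp: le_Suc_eq)
next
  case (Suc n)
  let ?s = "legendre_largest_zero (Suc n)" and ?s' = "legendre_largest_zero (Suc (Suc n))"
  let ?Z = "{t. poly (legendre (Suc (Suc n))) t = 0}"
  have "real (n + 2) * poly (legendre (Suc (Suc n))) ?s < 0"
    using Suc unfolding legendre_recurrence by simp
  then have "poly (legendre (Suc (Suc n))) ?s < 0"
    by (simp add: mult_less_0_iff)
  then obtain z where z: "?s < z" "z < 1" "poly (legendre (Suc (Suc n))) z = 0"
    using poly_IVT_pos[of ?s 1 "legendre (Suc (Suc n))"] Suc by (auto simp: poly_legendre_1)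
  have fin: "finite ?Z" by (rule finite_legendre_zeros)
  have mem: "?s' \<in> ?Z"
    unfolding legendre_largest_zero_def using fin z by (intro Max_in) auto
  have max: "x \<le> ?s'" if "x \<in> ?Z" for x
    unfolding legendre_largest_zero_def using fin that by (rule Max_ge)
  have gt: "?s < ?s'" using max[of z] z by simp
  have lt: "?s' < 1"
    using legendre_ge_1[of ?s' "Suc (Suc n)"] mem by force
  have "poly (legendre (Suc (Suc n))) t > 0" if "t > ?s'" for t
    by (rule legendre_pos_beyond[OF _ that]) (use max in force)
  then have "\<forall>k\<le>Suc (Suc n). \<forall>t>?s'. poly (legendre k) t > 0"
    using Suc gt by (auto simp: le_Suc_eq)
  then show ?case
    using mem Suc gt lt by auto
qed

text \<open>
  If $P_n > P_{n+1} > 0$ at $t < 1$, then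
  $(n+2) P_{n+2} < (2n+3) P_{n+1} - (n+1) P_{n+1} = (n+2) P_{n+1}$ by the recurrence. This elementary
  monotonicity is what makes $P_L$ on a cap a good sieve kernel.
\<close>

lemma legendre_strict_decreasing:
  assumes "\<And>k. k \<le> L \<Longrightarrow> poly (legendre k) t > 0" and "t < 1" and "k < m" and "m \<le> L"
  shows "poly (legendre m) t < poly (legendre k) t"
proof -
  let ?p = "\<lambda>n. poly (legendre n) t"
  have step: "?p (Suc n) < ?p n" if "Suc n \<le> L" for n
    using that
  proof (induction n)
    case 0
    then show ?case using assms by simp
  next
    case (Suc n)
    have "(2 * real n + 3) * t * ?p (Suc n) < (2 * real n + 3) * 1 * ?p (Suc n)"
      using assms Suc by (intro mult_strict_right_mono mult_strict_left_mono) auto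
    moreover have "real (n + 1) * ?p (Suc n) < real (n + 1) * ?p n"
      using Suc by (intro mult_strict_left_mono) auto
    ultimately have "real (n + 2) * ?p (Suc (Suc n)) < real (n + 2) * ?p (Suc n)"
      unfolding legendre_recurrence by (simp add: algebra_simps)
    then show ?case
      by (rule mult_left_less_imp_less) simp
  qed
  show ?thesis
    using \<open>k < m\<close> \<open>m \<le> L\<close>
  proof (induction m)
    case (Suc m)
    then show ?case
      using step[of m] by (cases "k = m") auto
  qed simp
qed

section \<open>Powers of quadratics and averages over roots of unity\<close>

lemma coeff_offset_poly:
  "coeff (pcompose p [:a, 1:]) j = poly ((pderiv ^^ j) p) a / fact j"
  for p :: "real poly"
proof -
  have coeff0: "fact j * coeff q j = poly ((pderiv ^^ j) q) 0" for q :: "real poly"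
  proof (induction j arbitrary: q)
    case 0
    show ?case by (simp add: poly_0_coeff_0)
  next
    case (Suc j)
    show ?case
      using Suc[of "pderiv q"]
      by (simp add: coeff_pderiv funpow_Suc_right algebra_simps del: funpow.simps)
  qed
  have comp: "(pderiv ^^ j) (pcompose p [:a, 1:]) = pcompose ((pderiv ^^ j) p) [:a, 1:]"
    by (induction j) (auto simp: pderiv_pcompose pderiv_pCons)
  show ?thesis
    using coeff0[of "pcompose p [:a, 1:]"] unfolding comp
    by (simp add: poly_pcompose field_simps)
qed

text \<open>
  The link between Rodrigues' formula and powers of quadratics: the quadratic is
  $((t + z)^2 - 1) / 2$, so its $l$-th power is the Taylor expansion of $(X^2 - 1)^l / 2^l$ at $t$.
\<close>

lemma coeff_rodrigues_quadratic:
  "coeff ([:(t\<^sup>2 - 1) / 2, t, 1 / 2:] ^ l) j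
     = poly ((pderiv ^^ j) ([:-1, 0, 1:] ^ l)) t / (2 ^ l * fact j)"
  for t :: real
proof -
  have "[:(t\<^sup>2 - 1) / 2, t, 1 / 2:] = smult (1 / 2) (pcompose [:-1, 0, 1:] [:t, 1:])"
    by (simp add: pcompose_pCons power2_eq_square algebra_simps)
  moreover have "pcompose q r ^ l = pcompose (q ^ l) r" for q r :: "real poly"
    by (induction l) (auto simp: pcompose_mult pcompose_1)
  ultimately have "[:(t\<^sup>2 - 1) / 2, t, 1 / 2:] ^ l
      = smult (1 / 2 ^ l) (pcompose ([:-1, 0, 1:] ^ l) [:t, 1:])"
    by (simp add: smult_power power_one_over)
  then show ?thesis
    by (simp add: coeff_offset_poly)
qed

lemma sum_cis_roots_of_unity:
  fixes k :: int
  assumes "\<bar>k\<bar> < int N"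
  shows "(\<Sum>j<N. cis (of_int k * (2 * pi * real j / real N))) = (if k = 0 then of_nat N else 0)"
proof (cases "k = 0")
  case False
  define z where "z = cis (2 * pi * of_int k / real N)"
  have N: "N > 0" using assms by auto
  have pow: "cis (of_int k * (2 * pi * real j / real N)) = z ^ j" for j
    unfolding z_def by (simp add: Complex.DeMoivre algebra_simps)
  have "z ^ N = cis (2 * pi * of_int k)"
    using N unfolding z_def by (simp add: Complex.DeMoivre)
  then have zN: "z ^ N = 1"
    by (simp add: cis_multiple_2pi)
  have "z \<noteq> 1"
  proof
    assume "z = 1"
    then have "cos (2 * pi * of_int k / real N) = 1"
      unfolding z_def by (metis cis.sel(1) one_complex.sel(1))
    then obtain n :: int where "2 * pi * of_int k / real N = of_int n * 2 * pi"
      by (auto simp: cos_one_2pi_int)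
    then have "(of_int k :: real) = of_int (n * int N)"
      using N by (simp add: field_simps)
    then have "k = n * int N" by (simp only: of_int_eq_iff)
    then have "\<bar>k\<bar> \<ge> int N"
      using False by (cases "n = 0") (auto simp: abs_mult)
    then show False using assms by simp
  qed
  then show ?thesis
    using False zN unfolding pow by (simp add: sum_gp_strict lessThan_def[symmetric] sum_gp_basic geometric_sum)
qed simp

lemma discrete_fourier_coeff:
  fixes p :: "complex poly"
  assumes "\<And>i. i \<le> degree p \<Longrightarrow> \<bar>int i - int n\<bar> < int N"
  shows "(\<Sum>j<N. cis (- (real n * (2 * pi * real j / real N))) * poly p (cis (2 * pi * real j / real N)))
           = of_nat N * coeff p n"
proof -
  have "(\<Sum>j<N. cis (- (real n * (2 * pi * real j / real N))) * poly p (cis (2 * pi * real j / real N)))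
      = (\<Sum>j<N. \<Sum>i\<le>degree p. coeff p i * cis (of_int (int i - int n) * (2 * pi * real j / real N)))"
    by (intro sum.cong refl)
       (simp add: poly_altdef sum_distrib_left Complex.DeMoivre cis_mult algebra_simps diff_divide_distrib)
  also have "\<dots> = (\<Sum>i\<le>degree p. coeff p i * (\<Sum>j<N. cis (of_int (int i - int n) * (2 * pi * real j / real N))))"
    by (subst sum.swap) (simp add: sum_distrib_left)
  also have "\<dots> = (\<Sum>i\<le>degree p. coeff p i * (if i = n then of_nat N else 0))"
  proof (intro sum.cong refl)
    fix i assume "i \<in> {..degree p}"
    then show "coeff p i * (\<Sum>j<N. cis (of_int (int i - int n) * (2 * pi * real j / real N)))
        = coeff p i * (if i = n then of_nat N else 0)"
      using sum_cis_roots_of_unity[OF assms, of i] by simp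
  qed
  also have "\<dots> = of_nat N * coeff p n"
    by (simp add: if_distrib[of "\<lambda>x. _ * x"] sum.delta' coeff_eq_0 not_le cong: if_cong)
  finally show ?thesis .
qed

lemma degree_quadratic_power: "degree ([:a, b, c:] ^ l) \<le> 2 * l"
proof -
  have "degree [:a, b, c:] \<le> 2" by simp
  then have "degree [:a, b, c:] * l \<le> 2 * l" by (rule mult_le_mono1)
  then show ?thesis
    using degree_power_le[of "[:a, b, c:]" l] by linarith
qed

lemma central_coeff_quadratic_power:
  fixes p q c :: complex
  shows "coeff ([:q, c, p:] ^ l) l
     = (\<Sum>k\<le>l. of_nat (l choose k) * c ^ (l - k) *
          (if even k then of_nat (k choose (k div 2)) * (p * q) ^ (k div 2) else 0))"
proof -
  have inner: "coeff ([:q, 0, p:] ^ k) k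
      = (if even k then of_nat (k choose (k div 2)) * (p * q) ^ (k div 2) else 0)" for k
  proof -
    have "[:q, 0, p:] = monom p 2 + [:q:]"
      by (simp add: monom_altdef numeral_2_eq_2)
    then have "coeff ([:q, 0, p:] ^ k) k
        = (\<Sum>i\<le>k. of_nat (k choose i) * coeff (monom p 2 ^ i * [:q:] ^ (k - i)) k)"
      by (simp add: binomial_ring coeff_sum mult.assoc of_nat_poly)
    also have "\<dots> = (\<Sum>i\<le>k. of_nat (k choose i) * (if 2 * i = k then p ^ i * q ^ (k - i) else 0))"
      by (intro sum.cong refl) (auto simp: monom_power poly_const_pow coeff_monom_mult mult.commute
          coeff_pCons split: nat.splits)
    also have "\<dots> = (\<Sum>i\<le>k. if i = k div 2 then
          (if even k then of_nat (k choose (k div 2)) * (p * q) ^ (k div 2) else 0) else 0)"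
    proof (intro sum.cong refl)
      fix i
      have "k - k div 2 = k div 2" if "even k" using that by auto
      then show "of_nat (k choose i) * (if 2 * i = k then p ^ i * q ^ (k - i) else 0)
        = (if i = k div 2 then
          (if even k then of_nat (k choose (k div 2)) * (p * q) ^ (k div 2) else 0) else 0)"
        by (auto simp: power_mult_distrib)
    qed
    finally show ?thesis by simp
  qed
  have "[:q, c, p:] = [:q, 0, p:] + monom c 1"
    by (simp add: monom_altdef)
  then have "coeff ([:q, c, p:] ^ l) l
      = (\<Sum>k\<le>l. of_nat (l choose k) * coeff ([:q, 0, p:] ^ k * monom c 1 ^ (l - k)) l)"
    by (simp add: binomial_ring coeff_sum mult.assoc of_nat_poly)
  also have "\<dots> = (\<Sum>k\<le>l. of_nat (l choose k) * c ^ (l - k) * coeff ([:q, 0, p:] ^ k) k)"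
    by (intro sum.cong refl) (auto simp: monom_power coeff_monom_mult mult.commute[of _ "monom _ _"])
  finally show ?thesis
    by (simp only: inner)
qed

text \<open>
  In $(q + c z + p z^2)^l$ a term contributes to $z^l$ only if it uses $q$ and $p$ equally often, so the
  central coefficient depends on $p$ and $q$ through $p q$ alone and is homogeneous of degree $l$ when
  $c$ has weight one and $p q$ weight two.
\<close>

lemma central_coeff_scale:
  fixes p q c a :: complex
  assumes "p * q = a\<^sup>2 * (p' * q')"
  shows "coeff ([:q, a * c, p:] ^ l) l = a ^ l * coeff ([:q', c, p':] ^ l) l"
  unfolding central_coeff_quadratic_power sum_distrib_left
proof (intro sum.cong refl)
  fix k assume k: "k \<in> {..l}"
  have "(a * c) ^ (l - k) * (p * q) ^ (k div 2) = a ^ l * (c ^ (l - k) * (p' * q') ^ (k div 2))"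
    if "even k"
  proof -
    have "a ^ (l - k) * (a\<^sup>2) ^ (k div 2) = a ^ l"
      using that k by (simp flip: power_mult power_add)
    have "(a * c) ^ (l - k) * (p * q) ^ (k div 2)
        = (a ^ (l - k) * (a\<^sup>2) ^ (k div 2)) * (c ^ (l - k) * (p' * q') ^ (k div 2))"
      by (simp only: assms power_mult_distrib mult_ac)
    then show ?thesis
      by (simp only: \<open>a ^ (l - k) * (a\<^sup>2) ^ (k div 2) = a ^ l\<close>)
  qed
  then show "of_nat (l choose k) * (a * c) ^ (l - k) *
      (if even k then of_nat (k choose (k div 2)) * (p * q) ^ (k div 2) else 0)
    = a ^ l * (of_nat (l choose k) * c ^ (l - k) *
      (if even k then of_nat (k choose (k div 2)) * (p' * q') ^ (k div 2) else 0))"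
    by (cases "even k") (simp_all add: mult_ac)
qed

lemma coeff_rodrigues_quadratic_complex:
  "coeff ([:of_real ((t\<^sup>2 - 1) / 2), of_real t, 1 / 2:] ^ l) j
     = complex_of_real (poly ((pderiv ^^ j) ([:-1, 0, 1:] ^ l)) t / (2 ^ l * fact j))"
proof -
  have mult: "map_poly complex_of_real (p * q) = map_poly of_real p * map_poly of_real q" for p q
    by (rule poly_eqI) (simp add: coeff_map_poly coeff_mult)
  have pow: "map_poly complex_of_real (p ^ n) = map_poly of_real p ^ n" for p n
    by (induction n) (auto simp: mult)
  have "[:of_real ((t\<^sup>2 - 1) / 2), of_real t, 1 / 2:]
      = map_poly complex_of_real [:(t\<^sup>2 - 1) / 2, t, 1 / 2:]"
    by (simp add: map_poly_pCons)
  then have "coeff ([:of_real ((t\<^sup>2 - 1) / 2), of_real t, 1 / 2:] ^ l) j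
      = complex_of_real (coeff ([:(t\<^sup>2 - 1) / 2, t, 1 / 2:] ^ l) j)"
    by (simp only: pow[symmetric]) (simp add: coeff_map_poly)
  then show ?thesis
    by (simp only: coeff_rodrigues_quadratic)
qed

text \<open>
  A coefficient form of Laplace's integral $P_l(t) = \frac{1}{\<pi>} \int_0^\<pi> (t + \sqrt{t^2 - 1} \cos \<psi>)^l d\<psi>$: by
  scaling, any quadratic with the same product $p q$ may replace the one from Rodrigues' formula.
\<close>

lemma central_coeff_legendre:
  fixes p q a :: complex
  assumes "p * q = of_real ((t\<^sup>2 - 1) / 4) * a\<^sup>2"
  shows "coeff ([:q, a * of_real t, p:] ^ l) l = a ^ l * of_real (poly (legendre l) t)"
proof -
  have "p * q = a\<^sup>2 * (1 / 2 * of_real ((t\<^sup>2 - 1) / 2))"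
    using assms by simp
  from central_coeff_scale[OF this, of "of_real t" l] show ?thesis
    unfolding coeff_rodrigues_quadratic_complex by (simp add: legendre_def)
qed

text \<open>
  The Fourier coefficients of $(c + p e^{i\<theta>} + q e^{-i\<theta>})^l = e^{-il\<theta>} (q + c e^{i\<theta>} + p e^{2i\<theta>})^l$. The
  frequencies lie in $[-l, l]$, so $N > l + |m|$ equidistant nodes compute the coefficient of
  $e^{im\<theta>}$ exactly. Finite averages in place of integrals avoid any exchange of limits.
\<close>

lemma sum_trigonometric_power:
  fixes c p q :: complex
  assumes "\<bar>m\<bar> \<le> int l" and "int l + \<bar>m\<bar> < int N"
  shows "(\<Sum>j<N. cis (- (of_int m * (2 * pi * real j / real N))) *
            (c + p * cis (2 * pi * real j / real N) + q * cis (- (2 * pi * real j / real N))) ^ l)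
     = of_nat N * coeff ([:q, c, p:] ^ l) (nat (m + int l))"
proof -
  have "\<bar>int i - int (nat (m + int l))\<bar> < int N" if "i \<le> degree ([:q, c, p:] ^ l)" for i
  proof -
    have "i \<le> 2 * l" using that degree_quadratic_power[of q c p l] by simp
    then show ?thesis using assms by auto
  qed
  from discrete_fourier_coeff[OF this] have
    "(\<Sum>j<N. cis (- (real (nat (m + int l)) * (2 * pi * real j / real N))) *
          poly ([:q, c, p:] ^ l) (cis (2 * pi * real j / real N)))
      = of_nat N * coeff ([:q, c, p:] ^ l) (nat (m + int l))" .
  moreover have "cis (- (real (nat (m + int l)) * \<theta>)) * poly ([:q, c, p:] ^ l) (cis \<theta>)
      = cis (- (of_int m * \<theta>)) * (c + p * cis \<theta> + q * cis (- \<theta>)) ^ l" for \<theta>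
  proof -
    have "real (nat (m + int l)) = of_int m + real l"
      using assms by (simp add: of_nat_nat)
    then have "cis (- (real (nat (m + int l)) * \<theta>)) = cis (- (of_int m * \<theta>)) * cis (- \<theta>) ^ l"
      by (simp add: Complex.DeMoivre cis_mult algebra_simps)
    moreover have "cis (- \<theta>) ^ l * poly ([:q, c, p:] ^ l) (cis \<theta>)
        = (c + p * cis \<theta> + q * cis (- \<theta>)) ^ l"
    proof -
      have "cis (- \<theta>) * cis \<theta> = 1" by (simp add: cis_mult)
      then have "cis (- \<theta>) * poly [:q, c, p:] (cis \<theta>) = c + p * cis \<theta> + q * cis (- \<theta>)"
        by simp algebra
      then show ?thesis
        unfolding poly_power by (simp flip: power_mult_distrib)
    qed
    ultimately show ?thesis by (simp add: mult.assoc)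
  qed
  ultimately show ?thesis by (simp only:)
qed

section \<open>Spherical harmonics as powers of null forms\<close>

text \<open>
  The complex linear form $x \<mapsto> \<langle>a, x\<rangle>$ with $a = u + i v$. It is kept as a pair of real vectors so that
  rotations act on $u$ and $v$ separately.
\<close>

definition null_form :: "real^3 \<Rightarrow> real^3 \<Rightarrow> real^3 \<Rightarrow> complex" where
  "null_form u v x = Complex (u \<bullet> x) (v \<bullet> x)"

text \<open>
  Says that $a = u + i v$ is isotropic for the bilinear product, $a_1^2 + a_2^2 + a_3^2 = 0$. Then the
  powers of $\<langle>a, x\<rangle>$ are harmonic polynomials.
\<close>

definition null_pair :: "real^3 \<Rightarrow> real^3 \<Rightarrow> bool" where
  "null_pair u v \<longleftrightarrow> u \<bullet> u = v \<bullet> v \<and> u \<bullet> v = 0"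

definition rotation3 :: "real \<Rightarrow> real^3 \<Rightarrow> real^3" where
  "rotation3 \<theta> y = vector [cos \<theta> * y$1 - sin \<theta> * y$2, sin \<theta> * y$1 + cos \<theta> * y$2, y$3]"

lemma orthogonal_transformation_rotation3: "orthogonal_transformation (rotation3 \<theta>)"
proof -
  have "linear (rotation3 \<theta>)"
    by (rule linearI) (simp_all add: rotation3_def vec_eq_iff forall_3 algebra_simps)
  moreover have "norm (rotation3 \<theta> y) = norm y" for y
  proof -
    have "(cos \<theta> * y$1 - sin \<theta> * y$2)\<^sup>2 + (sin \<theta> * y$1 + cos \<theta> * y$2)\<^sup>2
        = (y$1)\<^sup>2 + (y$2)\<^sup>2"
      using sin_cos_squared_add[of \<theta>] by algebra
    then show ?thesis
      by (simp add: norm_eq_sqrt_inner inner_vec_def sum_3 rotation3_def power2_eq_square)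
  qed
  ultimately show ?thesis by (simp add: orthogonal_transformation)
qed

lemma null_pair_components:
  assumes "null_pair u v"
  shows "(Complex (u$1) (v$1))\<^sup>2 + (Complex (u$2) (v$2))\<^sup>2 = - (Complex (u$3) (v$3))\<^sup>2"
proof (rule complex_eqI)
  show "Re ((Complex (u$1) (v$1))\<^sup>2 + (Complex (u$2) (v$2))\<^sup>2) = Re (- (Complex (u$3) (v$3))\<^sup>2)"
    using assms by (simp add: null_pair_def inner_vec_def sum_3 power2_eq_square)
  show "Im ((Complex (u$1) (v$1))\<^sup>2 + (Complex (u$2) (v$2))\<^sup>2) = Im (- (Complex (u$3) (v$3))\<^sup>2)"
    using assms by (simp add: null_pair_def inner_vec_def sum_3 power2_eq_square mult.commute)
qed

text \<open>
  The rotated form is $a_3 y_3 + p e^{i\<theta>} + q e^{-i\<theta>}$ with $4 p q = (a_1^2 + a_2^2)(y_1^2 + y_2^2) =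
  a_3^2 (y_3^2 - 1)$ by isotropy and $|y| = 1$. Averaging leaves the central coefficient
  of its $l$-th power, which is a Legendre polynomial. So averaging about the axis turns the power into
  the zonal function of degree $l$ with the same value at the pole.
\<close>

lemma average_null_form_power:
  assumes "null_pair u v" and "norm y = 1" and "l < N"
  shows "(\<Sum>j<N. null_form u v (rotation3 (2 * pi * real j / real N) y) ^ l)
     = of_nat N * (of_real (poly (legendre l) (y$3)) * null_form u v (axis 3 1) ^ l)"
proof -
  define a where "a = (\<lambda>i. Complex (u$i) (v$i))"
  define w where "w = Complex (y$1) (y$2)"
  define p where "p = (a 1 - \<i> * a 2) / 2 * w"
  define q where "q = (a 1 + \<i> * a 2) / 2 * cnj w"
  have form: "null_form u v (rotation3 \<theta> y) = a 3 * of_real (y$3) + p * cis \<theta> + q * cis (- \<theta>)" for \<theta>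
    by (simp add: null_form_def rotation3_def inner_vec_def sum_3 a_def p_def q_def w_def
        complex_eq_iff) (simp add: field_simps)
  have "(y$1)\<^sup>2 + (y$2)\<^sup>2 = 1 - (y$3)\<^sup>2"
    using assms(2) by (simp add: norm_eq_1 inner_vec_def sum_3 power2_eq_square)
  then have "w * cnj w = of_real (1 - (y$3)\<^sup>2)"
    unfolding w_def by (simp add: complex_mult_cnj)
  moreover have "p * q = ((a 1)\<^sup>2 + (a 2)\<^sup>2) / 4 * (w * cnj w)"
    unfolding p_def q_def by (simp add: field_simps power2_eq_square)
  moreover have "(a 1)\<^sup>2 + (a 2)\<^sup>2 = - (a 3)\<^sup>2"
    unfolding a_def by (rule null_pair_components[OF assms(1)])
  ultimately have "p * q = - (a 3)\<^sup>2 / 4 * of_real (1 - (y$3)\<^sup>2)"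
    by (simp only:)
  then have "p * q = of_real (((y$3)\<^sup>2 - 1) / 4) * (a 3)\<^sup>2"
    by (simp add: field_simps)
  then have "coeff ([:q, a 3 * of_real (y$3), p:] ^ l) l = a 3 ^ l * of_real (poly (legendre l) (y$3))"
    by (rule central_coeff_legendre)
  moreover have "null_form u v (axis 3 1) = a 3"
    by (simp add: null_form_def a_def inner_axis)
  ultimately show ?thesis
    using sum_trigonometric_power[of 0 l N "a 3 * of_real (y$3)" p q] assms(3)
    by (simp add: form mult.commute)
qed

text \<open>
  Put $w = x_1 + i x_2 = s e^{i\<phi>}$ and $t = x_3$. Substituting $\<kappa> z$ with $\<kappa> = i w$ into the quadratic
  $((t + z)^2 - 1)/2$ from Rodrigues' formula and dividing by $\<kappa>$ gives $\frac{i}{2} \bar w + t z + \frac{i}{2} w z^2$,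
  because $w \bar w = 1 - t^2$. The coefficient of $z^{l+m}$ in its $l$-th power is therefore $\<kappa>^m$, that is
  $i^m s^m e^{im\<phi>}$, times $D^{l+m} (t^2 - 1)^l$ up to a constant: this is $Y_l^m$. At the poles $\<kappa> = 0$, and for
  $m = 0$ the coefficient is central and depends only on the product of the outer coefficients.
\<close>

lemma spherical_harmonic_eq_coeff:
  assumes "\<bar>m\<bar> \<le> int l"
  obtains C where "\<And>x. x \<in> sphere 0 1 \<Longrightarrow> spherical_harmonic l m x
     = C * coeff ([:\<i> / 2 * cnj (Complex (x$1) (x$2)), of_real (x$3), \<i> / 2 * Complex (x$1) (x$2):] ^ l)
             (nat (m + int l))"
proof
  define n where "n = sqrt ((2 * real l + 1) / (4 * pi) * (fact (nat (int l - m)) / fact (nat (int l + m))))"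
  define k where "k = nat (m + int l)"
  define C where "C = of_real n * ((-1) ^ k * (-1) ^ l * fact k / (fact l * \<i> powi m))"
  fix x :: "real^3" assume x: "x \<in> sphere 0 1"
  define t where "t = x$3"
  define w where "w = Complex (x$1) (x$2)"
  define \<phi> where "\<phi> = Arg w"
  define s where "s = sqrt (1 - t\<^sup>2)"
  define R where "R = [:\<i> / 2 * cnj w, of_real t, \<i> / 2 * w:]"
  define D where "D = poly ((pderiv ^^ k) ([:-1, 0, 1:] ^ l)) t"
  have sum1: "(x$1)\<^sup>2 + (x$2)\<^sup>2 + t\<^sup>2 = 1"
    using x by (simp add: norm_eq_1 inner_vec_def sum_3 power2_eq_square t_def)
  then have cmod_w: "cmod w = s"
    unfolding w_def s_def by (simp add: cmod_def)
  have w: "w = of_real s * cis \<phi>"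
    using rcis_cmod_Arg[of w] unfolding \<phi>_def cmod_w rcis_def by simp
  have "[:1, 0, -1:] = - [:-1, 0, 1 :: real:]" by simp
  then have "[:1, 0, -1:] ^ l = smult ((-1) ^ l) ([:-1, 0, 1 :: real:] ^ l)"
    by (metis smult_1_left smult_minus_left smult_power)
  then have assoc: "assoc_legendre l m t = (-1) ^ k / (2 ^ l * fact l) * s powi m * ((-1) ^ l * D)"
    unfolding assoc_legendre_def s_def D_def k_def by (simp add: higher_pderiv_smult)
  have expi: "exp (\<i> * of_int m * of_real \<phi>) = cis \<phi> powi m"
    by (simp add: cis_conv_exp exp_power_int mult_ac)
  have Y: "spherical_harmonic l m x
     = of_real n * (of_real (assoc_legendre l m t) * cis \<phi> powi m)"
    unfolding spherical_harmonic_def n_def t_def[symmetric] w_def[symmetric] \<phi>_def[symmetric] expi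
    by simp
  have "spherical_harmonic l m x = C * coeff (R ^ l) k"
  proof (cases "m = 0")
    case True
    have kl: "k = l" using True by (simp add: k_def)
    have "w * cnj w = of_real (1 - t\<^sup>2)"
      unfolding w_def using sum1 by (subst complex_mult_cnj, intro arg_cong[where f = of_real]) simp
    then have "(\<i> / 2 * w) * (\<i> / 2 * cnj w) = of_real ((t\<^sup>2 - 1) / 4) * 1\<^sup>2"
      by (simp add: field_simps)
    from central_coeff_legendre[OF this, of l]
    have "coeff (R ^ l) k = of_real (poly (legendre l) t)"
      unfolding R_def kl by simp
    also have "\<dots> = of_real (D / (2 ^ l * fact l))"
      unfolding legendre_def D_def kl by simp
    finally show ?thesis
      unfolding Y assoc C_def using True by (simp add: kl)
  next
    case False
    show ?thesis
    \<comment> \<open>At the poles both sides vanish: the sine factor on the left, a noncentral coefficient of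
        \<open>(t z)\<^sup>l\<close> on the right.\<close>
    proof (cases "s = 0")
      case True
      then have "R = monom (of_real t) 1"
        unfolding R_def w by (simp add: monom_altdef)
      then have "R ^ l = monom (of_real t ^ l) l"
        by (simp add: monom_power)
      moreover have "k \<noteq> l" using False assms by (simp add: k_def)
      ultimately have "coeff (R ^ l) k = 0" by simp
      moreover have "assoc_legendre l m t = 0"
        unfolding assoc using True False by simp
      ultimately show ?thesis unfolding Y by simp
    next
      case nz: False
      define \<kappa> where "\<kappa> = \<i> * w"
      have \<kappa>0: "\<kappa> \<noteq> 0" unfolding \<kappa>_def using w nz by simp
      have ww: "w * cnj w = of_real (1 - t\<^sup>2)"
        unfolding w_def using sum1 by (subst complex_mult_cnj, intro arg_cong[where f = of_real]) simp
      have "smult \<kappa> R = pcompose [:of_real ((t\<^sup>2 - 1) / 2), of_real t, 1 / 2:] [:0, \<kappa>:]"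
        using ww unfolding R_def \<kappa>_def by (simp add: pcompose_pCons field_simps)
      moreover have "pcompose q r ^ l = pcompose (q ^ l) r" for q r :: "complex poly"
        by (induction l) (auto simp: pcompose_mult pcompose_1)
      ultimately have "smult (\<kappa> ^ l) (R ^ l)
          = pcompose ([:of_real ((t\<^sup>2 - 1) / 2), of_real t, 1 / 2:] ^ l) [:0, \<kappa>:]"
        by (simp only: smult_power[symmetric])
      then have "\<kappa> ^ l * coeff (R ^ l) k
          = \<kappa> ^ k * coeff ([:of_real ((t\<^sup>2 - 1) / 2), of_real t, 1 / 2:] ^ l) k"
        by (metis coeff_smult coeff_pcompose_linear)
      also have "\<kappa> ^ k = \<kappa> ^ l * \<kappa> powi m"
      proof -
        have "\<kappa> ^ k = \<kappa> powi (int l + m)"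
          unfolding k_def using assms by (simp add: power_int_def add.commute)
        then show ?thesis using \<kappa>0 by (simp add: power_int_add)
      qed
      finally have "\<kappa> ^ l * coeff (R ^ l) k = \<kappa> ^ l * (\<kappa> powi m * of_real (D / (2 ^ l * fact k)))"
        unfolding coeff_rodrigues_quadratic_complex D_def by (simp only: mult.assoc)
      then have coeff: "coeff (R ^ l) k = \<kappa> powi m * of_real (D / (2 ^ l * fact k))"
        using \<kappa>0 by (subst (asm) mult_left_cancel) auto
      have "\<kappa> powi m = \<i> powi m * of_real (s powi m) * cis \<phi> powi m"
        unfolding \<kappa>_def w by (simp add: power_int_mult_distrib)
      then show ?thesis
        unfolding Y assoc C_def coeff by (simp add: field_simps)
    qed
  qed
  then show "spherical_harmonic l m x
     = C * coeff ([:\<i> / 2 * cnj (Complex (x$1) (x$2)), of_real (x$3), \<i> / 2 * Complex (x$1) (x$2):] ^ l)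
             (nat (m + int l))"
    unfolding R_def t_def w_def k_def .
qed

text \<open>
  The isotropic vectors $(i \cos \<alpha>, i \sin \<alpha>, 1)$ for the $2l + 1$ angles $\<alpha> = -2\<pi>j/(2l+1)$, as many as the
  space of harmonics of degree $l$ has dimensions. The sign of the angle makes $e^{im\<phi>}$ the Fourier
  coefficient of frequency $m$.
\<close>

definition circle_form :: "nat \<Rightarrow> nat \<Rightarrow> real^3 \<Rightarrow> complex" where
  "circle_form l j =
     null_form (axis 3 1)
       (vector [cos (2 * pi * real j / real (2 * l + 1)), - sin (2 * pi * real j / real (2 * l + 1)), 0])"

text \<open>
  $Y_l^m(x)$ is a Fourier coefficient of $\<alpha> \<mapsto> (x_3 + i x_1 \cos \<alpha> + i x_2 \sin \<alpha>)^l$, hence a combination of the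
  values at $2l + 1$ nodes.
\<close>

lemma spherical_harmonic_eq_sum_null_forms:
  assumes "\<bar>m\<bar> \<le> int l"
  obtains d where "\<And>x. x \<in> sphere 0 1 \<Longrightarrow>
     spherical_harmonic l m x = (\<Sum>j<2 * l + 1. d j * circle_form l j x ^ l)"
proof -
  from spherical_harmonic_eq_coeff[OF assms] obtain C where
    C: "\<And>x. x \<in> sphere 0 1 \<Longrightarrow> spherical_harmonic l m x
     = C * coeff ([:\<i> / 2 * cnj (Complex (x$1) (x$2)), of_real (x$3), \<i> / 2 * Complex (x$1) (x$2):] ^ l)
             (nat (m + int l))" by blast
  define N where "N = 2 * l + 1"
  define d where "d = (\<lambda>j. C / of_nat N * cis (- (of_int m * (2 * pi * real j / real N))))"
  show ?thesis
  proof (rule that[of d])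
    fix x :: "real^3" assume x: "x \<in> sphere 0 1"
    define w where "w = Complex (x$1) (x$2)"
    have form: "of_real (x$3) + \<i> / 2 * w * cis \<theta> + \<i> / 2 * cnj w * cis (- \<theta>)
        = null_form (axis 3 1) (vector [cos \<theta>, - sin \<theta>, 0]) x" for \<theta>
      by (simp add: null_form_def inner_vec_def sum_3 w_def complex_eq_iff axis_def)
         (simp add: field_simps)
    have "(\<Sum>j<N. cis (- (of_int m * (2 * pi * real j / real N))) * circle_form l j x ^ l)
        = of_nat N * coeff ([:\<i> / 2 * cnj w, of_real (x$3), \<i> / 2 * w:] ^ l) (nat (m + int l))"
      using sum_trigonometric_power[OF assms, of N "of_real (x$3)" "\<i> / 2 * w" "\<i> / 2 * cnj w"] assms
      unfolding form circle_form_def N_def[symmetric] by (simp add: N_def)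
    then have "C / of_nat N * (\<Sum>j<N. cis (- (of_int m * (2 * pi * real j / real N))) * circle_form l j x ^ l)
        = spherical_harmonic l m x"
      unfolding C[OF x] w_def by (simp add: N_def del: of_nat_add of_nat_Suc)
    then show "spherical_harmonic l m x = (\<Sum>j<2 * l + 1. d j * circle_form l j x ^ l)"
      unfolding d_def N_def[symmetric] sum_distrib_left by (simp add: mult.assoc)
  qed
qed

lemma spherical_polys_eq_sum_null_forms:
  assumes "f \<in> spherical_polys L"
  shows "\<exists>d. \<forall>x\<in>sphere 0 1.
     f x = (\<Sum>l\<le>L. \<Sum>j<2 * l + 1. d l j * circle_form l j x ^ l)"
proof -
  from assms obtain c where c: "\<And>x. x \<in> sphere 0 1 \<Longrightarrow>
      f x = (\<Sum>l\<le>L. \<Sum>m\<in>{- int l..int l}. c l m * spherical_harmonic l m x)"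
    unfolding spherical_polys_def by blast
  have "\<exists>e. \<forall>x\<in>sphere 0 1. \<bar>m\<bar> \<le> int l \<longrightarrow>
      spherical_harmonic l m x = (\<Sum>j<2 * l + 1. e j * circle_form l j x ^ l)" for l m
    by (metis spherical_harmonic_eq_sum_null_forms)
  then have "\<exists>e. \<forall>l m. \<forall>x\<in>sphere 0 1. \<bar>m\<bar> \<le> int l \<longrightarrow>
      spherical_harmonic l m x = (\<Sum>j<2 * l + 1. e l m j * circle_form l j x ^ l)"
    by - (rule choice, rule allI, rule choice, rule allI, assumption)
  then obtain e where e: "\<And>l m x. x \<in> sphere 0 1 \<Longrightarrow> \<bar>m\<bar> \<le> int l \<Longrightarrow>
      spherical_harmonic l m x = (\<Sum>j<2 * l + 1. e l m j * circle_form l j x ^ l)"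
    by blast
  show ?thesis
  proof (intro exI[of _ "\<lambda>l j. \<Sum>m\<in>{- int l..int l}. c l m * e l m j"] ballI)
    fix x :: "real^3" assume x: "x \<in> sphere 0 1"
    have "(\<Sum>m\<in>{- int l..int l}. c l m * spherical_harmonic l m x)
        = (\<Sum>j<2 * l + 1. (\<Sum>m\<in>{- int l..int l}. c l m * e l m j) * circle_form l j x ^ l)" for l
    proof -
      have "(\<Sum>m\<in>{- int l..int l}. c l m * spherical_harmonic l m x)
          = (\<Sum>m\<in>{- int l..int l}. \<Sum>j<2 * l + 1. c l m * e l m j * circle_form l j x ^ l)"
        using e[OF x] by (intro sum.cong refl) (auto simp: sum_distrib_left mult.assoc simp del: sum.lessThan_Suc)
      also have "\<dots> = (\<Sum>j<2 * l + 1. \<Sum>m\<in>{- int l..int l}. c l m * e l m j * circle_form l j x ^ l)"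
        by (rule sum.swap)
      finally show ?thesis by (simp only: sum_distrib_right)
    qed
    then show "f x = (\<Sum>l\<le>L. \<Sum>j<2 * l + 1. (\<Sum>m\<in>{- int l..int l}. c l m * e l m j) * circle_form l j x ^ l)"
      by (simp only: c[OF x])
  qed
qed

lemma circle_form_null:
  obtains u v where "null_pair u v" and "circle_form l j = null_form u v"
proof
  show "null_pair (axis 3 1) (vector [cos (2 * pi * real j / real (2 * l + 1)),
      - sin (2 * pi * real j / real (2 * l + 1)), 0])"
    by (simp add: null_pair_def inner_axis' inner_vec_def sum_3 axis_def flip: power2_eq_square)
qed (simp add: circle_form_def)

section \<open>Surface measure: rotations and heights\<close>

text \<open>
  The Borel version of the surface measure. All functions met below are Borel on the sphere, and for
  these the completion gives the same integrals.
\<close>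

abbreviation \<sigma> :: "(real^3) measure" where
  "\<sigma> \<equiv> sphere_borel_measure"

lemma emeasure_sigma_space: "emeasure \<sigma> (sphere 0 1) = ennreal (4 * pi)"
  using emeasure_sphere_measure_sphere
  by (simp add: sphere_measure_def sets_restrict_space_iff)

lemma finite_measure_sigma: "finite_measure \<sigma>"
  by (rule finite_measureI) (simp add: emeasure_sigma_space)

lemma measurable_sigma:
  fixes f :: "real^3 \<Rightarrow> 'b::topological_space"
  assumes "f \<in> borel_measurable borel"
  shows "f \<in> borel_measurable \<sigma>"
proof -
  have "f \<in> borel_measurable (restrict_space borel (sphere 0 1))"
    using assms by (rule measurable_restrict_space1)
  then show ?thesis
    by (subst measurable_cong_sets[OF sets_sphere_borel_measure refl])
qed

lemma measurable_sigma_rotation: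
  assumes T: "orthogonal_transformation T"
  shows "T \<in> \<sigma> \<rightarrow>\<^sub>M \<sigma>"
proof -
  have lin: "linear T" and nrm: "\<And>x. norm (T x) = norm x"
    using T by (auto simp: orthogonal_transformation)
  have "T \<in> borel_measurable borel"
    using lin by (intro borel_measurable_continuous_onI linear_continuous_on)
       (simp add: linear_conv_bounded_linear)
  then have "T \<in> restrict_space borel (sphere 0 1) \<rightarrow>\<^sub>M restrict_space borel (sphere 0 1)"
    by (intro measurable_restrict_space3) (auto simp: nrm)
  then show meas: "T \<in> \<sigma> \<rightarrow>\<^sub>M \<sigma>"
    by (subst measurable_cong_sets[OF sets_sphere_borel_measure sets_sphere_borel_measure])
qed

lemma distr_sigma_rotation:
  assumes T: "orthogonal_transformation T"
  shows "distr \<sigma> \<sigma> T = \<sigma>"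
proof (rule measure_eqI)
  have nrm: "\<And>x. norm (T x) = norm x"
    using T by (auto simp: orthogonal_transformation)
  fix A assume "A \<in> sets (distr \<sigma> \<sigma> T)"
  then have A: "A \<in> sets (restrict_space borel (sphere 0 1))" by simp
  then have "A \<subseteq> sphere 0 1" by (auto simp: sets_restrict_space)
  then have "T -` A \<inter> space \<sigma> = T -` A" using nrm by force
  then show "emeasure (distr \<sigma> \<sigma> T) A = emeasure \<sigma> A"
    using A sphere_borel_measure_rotation_invariant[OF T A] measurable_sigma_rotation[OF T]
    by (simp add: emeasure_distr)
qed simp

lemma measurable_vector_3:
  "(\<lambda>(z, x, y). vector [x, y, z] :: real^3) \<in> borel_measurable (borel :: (real \<times> (real \<times> real)) measure)"
proof (rule borel_measurable_continuous_onI)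
  have "(\<lambda>(z, x, y). vector [x, y, z] :: real^3)
      = (\<lambda>p. fst (snd p) *\<^sub>R axis 1 1 + snd (snd p) *\<^sub>R axis 2 1 + fst p *\<^sub>R axis 3 1)"
    by (auto simp: fun_eq_iff vec_eq_iff forall_3 axis_def)
  then show "continuous_on UNIV (\<lambda>(z, x, y). vector [x, y, z] :: real^3)"
    by (simp only:) (intro continuous_intros)
qed

lemma lborel_vec3_eq_distr:
  "(lborel :: (real^3) measure)
     = distr (lborel :: (real \<times> (real \<times> real)) measure) borel (\<lambda>(z, x, y). vector [x, y, z])"
proof (rule lborel_eqI)
  fix l u :: "real^3"
  assume le: "\<And>b. b \<in> Basis \<Longrightarrow> l \<bullet> b \<le> u \<bullet> b"
  then have le3: "l$i \<le> u$i" for i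
    using le[of "axis i 1"] by (simp add: inner_axis)
  have "(\<lambda>(z, x, y). vector [x, y, z] :: real^3) -` box l u
      = {l$3<..<u$3} \<times> ({l$1<..<u$1} \<times> {l$2<..<u$2})"
    by (auto simp: mem_box_cart forall_3)
  then have "emeasure (distr lborel borel (\<lambda>(z, x, y). vector [x, y, z] :: real^3)) (box l u)
      = emeasure (lborel \<Otimes>\<^sub>M (lborel \<Otimes>\<^sub>M lborel)) ({l$3<..<u$3} \<times> ({l$1<..<u$1} \<times> {l$2<..<u$2}))"
    using measurable_vector_3 by (simp add: emeasure_distr lborel_prod)
  also have "\<dots> = ennreal (u$3 - l$3) * (ennreal (u$1 - l$1) * ennreal (u$2 - l$2))"
    using le3 by (simp add: lborel.emeasure_pair_measure_Times lborel_pair.emeasure_pair_measure_Times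
        sigma_finite_measure.emeasure_pair_measure_Times[OF sigma_finite_pair_measure[OF sigma_finite_lborel sigma_finite_lborel]])
  also have "\<dots> = ennreal ((u$3 - l$3) * ((u$1 - l$1) * (u$2 - l$2)))"
    using le3 by (simp add: ennreal_mult)
  also have "(u$3 - l$3) * ((u$1 - l$1) * (u$2 - l$2)) = (\<Prod>b\<in>Basis. (u - l) \<bullet> b)"
  proof -
    have "(\<Prod>b\<in>Basis. (u - l) \<bullet> b) = (\<Prod>i\<in>UNIV. (u - l) \<bullet> axis i 1)"
      unfolding Basis_vec_def by (simp add: prod.UNION_disjoint axis_eq_axis)
    also have "\<dots> = (u$1 - l$1) * (u$2 - l$2) * (u$3 - l$3)"
      unfolding UNIV_3 by (simp add: inner_axis)
    finally show ?thesis by simp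
  qed
  finally show "emeasure (distr lborel borel (\<lambda>(z, x, y). vector [x, y, z] :: real^3)) (box l u)
      = ennreal (\<Prod>b\<in>Basis. (u - l) \<bullet> b)" .
qed simp

text \<open>
  The volume of the part of the unit ball inside the cone $x_3 > t |x|$, as the integral over the height
  of the areas of its horizontal slices (\<open>polar_cone_slice_area\<close>). For $t = 0$ the first summand has
  coefficient $0$ by the convention for division and is integrated over a single point.
\<close>

lemma nn_integral_cone_profile:
  assumes "0 \<le> t" "t \<le> 1"
  shows "(\<integral>\<^sup>+z. ennreal (pi * (z\<^sup>2 * (1 - t\<^sup>2) / t\<^sup>2)) * indicator {0..t} z
            + ennreal (pi * (1 - z\<^sup>2)) * indicator {t..1} z \<partial>lborel) = ennreal (2 * pi / 3 * (1 - t))"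
proof -
  have t2: "t\<^sup>2 \<le> 1" using assms by (simp add: power_le_one)
  \<comment> \<open>The constant is named so that the antiderivative has no division by \<open>t\<close>.\<close>
  define c where "c = pi * (1 - t\<^sup>2) / t\<^sup>2"
  have c: "c \<ge> 0" unfolding c_def using t2 by simp
  have "(\<integral>\<^sup>+z. ennreal (c * z\<^sup>2) * indicator {0..t} z \<partial>lborel)
      = ennreal (c / 3 * t ^ 3 - c / 3 * 0 ^ 3)"
    using assms c by (intro nn_integral_FTC_Icc) (auto intro!: derivative_eq_intros)
  then have a: "(\<integral>\<^sup>+z. ennreal (pi * (z\<^sup>2 * (1 - t\<^sup>2) / t\<^sup>2)) * indicator {0..t} z \<partial>lborel)
      = ennreal (pi * (1 - t\<^sup>2) / t\<^sup>2 / 3 * t ^ 3)"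
    unfolding c_def by (simp add: mult_ac)
  have b: "(\<integral>\<^sup>+z. ennreal (pi * (1 - z\<^sup>2)) * indicator {t..1} z \<partial>lborel)
      = ennreal (pi * (1 - 1 ^ 3 / 3) - pi * (t - t ^ 3 / 3))"
  proof (intro nn_integral_FTC_Icc[where F = "\<lambda>z. pi * (z - z ^ 3 / 3)"])
    fix z assume "z \<in> {t..1}"
    then show "0 \<le> pi * (1 - z\<^sup>2)"
      using assms by (intro mult_nonneg_nonneg) (auto simp: power_le_one)
  qed (use assms in \<open>auto intro!: derivative_eq_intros\<close>)
  have "pi * (1 - 1 ^ 3 / 3) - pi * (t - t ^ 3 / 3) = pi / 3 * ((1 - t) * (1 - t) * (2 + t))"
    by (simp add: field_simps power3_eq_cube)
  then have nn: "0 \<le> pi * (1 - 1 ^ 3 / 3) - pi * (t - t ^ 3 / 3)"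
    using assms pi_gt_zero by (simp only:) (intro mult_nonneg_nonneg; simp)
  have "(\<integral>\<^sup>+z. ennreal (pi * (z\<^sup>2 * (1 - t\<^sup>2) / t\<^sup>2)) * indicator {0..t} z
            + ennreal (pi * (1 - z\<^sup>2)) * indicator {t..1} z \<partial>lborel)
     = ennreal (pi * (1 - t\<^sup>2) / t\<^sup>2 / 3 * t ^ 3) + ennreal (pi * (1 - 1 ^ 3 / 3) - pi * (t - t ^ 3 / 3))"
    by (subst nn_integral_add) (measurable, simp only: a b)
  also have "\<dots> = ennreal (pi * (1 - t\<^sup>2) / t\<^sup>2 / 3 * t ^ 3 + (pi * (1 - 1 ^ 3 / 3) - pi * (t - t ^ 3 / 3)))"
    using assms t2 nn by (subst ennreal_plus) auto
  also have "pi * (1 - t\<^sup>2) / t\<^sup>2 / 3 * t ^ 3 + (pi * (1 - 1 ^ 3 / 3) - pi * (t - t ^ 3 / 3))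
      = 2 * pi / 3 * (1 - t)"
    by (cases "t = 0") (simp_all add: field_simps power2_eq_square power3_eq_cube)
  finally show ?thesis .
qed

text \<open>
  Below height $t$ the cone bounds the slice, above it the sphere does; in both cases the slice is a
  disc about the axis. Only $z = 0$ and $z = t$ are left out, a null set.
\<close>

lemma polar_cone_slice_area:
  fixes t z :: real
  assumes "0 \<le> t" and "t \<le> 1" and "z \<noteq> 0" and "z \<noteq> t"
  shows "emeasure lborel {p :: real \<times> real. z\<^sup>2 + (norm p)\<^sup>2 \<le> 1 \<and> t * sqrt (z\<^sup>2 + (norm p)\<^sup>2) < z}
     = ennreal (pi * (z\<^sup>2 * (1 - t\<^sup>2) / t\<^sup>2)) * indicator {0..t} z
            + ennreal (pi * (1 - z\<^sup>2)) * indicator {t..1} z"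
proof -
  have disc: "emeasure lborel (cball (0 :: real \<times> real) r) = ennreal (pi * r\<^sup>2)"
       "emeasure lborel (ball (0 :: real \<times> real) r) = ennreal (pi * r\<^sup>2)" if "0 \<le> r" for r
    using that by (simp_all add: emeasure_cball emeasure_ball unit_ball_vol_2 power2_eq_square)
  let ?S = "{p :: real \<times> real. z\<^sup>2 + (norm p)\<^sup>2 \<le> 1 \<and> t * sqrt (z\<^sup>2 + (norm p)\<^sup>2) < z}"
  consider "z < 0 \<or> z > 1" | "0 < z" "z < t" "z \<le> 1" | "0 < z" "t < z" "z \<le> 1"
    using assms by linarith
  then show ?thesis
  proof cases
    case 1
    have "?S = {}"
    proof -
      have False if "z\<^sup>2 + (norm p)\<^sup>2 \<le> 1" "t * sqrt (z\<^sup>2 + (norm p)\<^sup>2) < z" for p :: "real \<times> real"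
      proof -
        have "z > 0" using that(2) assms(1) by (smt (verit) mult_nonneg_nonneg real_sqrt_ge_zero sum_power2_ge_zero)
        moreover have "z\<^sup>2 \<le> 1" using that(1) by (smt (verit) zero_le_power2)
        ultimately show False using 1 by (simp add: power_le_one_iff abs_square_le_1)
      qed
      then show ?thesis by blast
    qed
    then show ?thesis using 1 assms by (simp only:) auto
  next
    case 2
    have t: "t > 0" using 2 by linarith
    show ?thesis
    proof (cases "t < 1")
      case True
      define r where "r = sqrt (z\<^sup>2 * (1 - t\<^sup>2) / t\<^sup>2)"
      have t2: "t\<^sup>2 < 1" using True t by (simp add: power_less_one_iff)
      have r2: "r\<^sup>2 = z\<^sup>2 * (1 - t\<^sup>2) / t\<^sup>2" and r0: "r \<ge> 0" unfolding r_def using t2 by auto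
      have "p \<in> ?S \<longleftrightarrow> norm p < r" for p
      proof -
        have "t * sqrt (z\<^sup>2 + (norm p)\<^sup>2) < z \<longleftrightarrow> (t * sqrt (z\<^sup>2 + (norm p)\<^sup>2))\<^sup>2 < z\<^sup>2"
          using 2 t by (intro iffI power_strict_mono) (auto intro: power2_less_imp_less)
        also have "\<dots> \<longleftrightarrow> t\<^sup>2 * (z\<^sup>2 + (norm p)\<^sup>2) < z\<^sup>2"
          by (simp add: power_mult_distrib)
        also have "\<dots> \<longleftrightarrow> (norm p)\<^sup>2 < r\<^sup>2"
          unfolding r2 using t by (simp add: field_simps)
        also have "\<dots> \<longleftrightarrow> norm p < r"
          using r0 by (meson norm_ge_zero power2_less_imp_less power_strict_mono zero_less_numeral)
        finally have iff: "t * sqrt (z\<^sup>2 + (norm p)\<^sup>2) < z \<longleftrightarrow> norm p < r" .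
        moreover have "z\<^sup>2 + (norm p)\<^sup>2 \<le> 1" if "t * sqrt (z\<^sup>2 + (norm p)\<^sup>2) < z"
        proof -
          have "t * sqrt (z\<^sup>2 + (norm p)\<^sup>2) < t * 1" using that 2 by linarith
          then have "sqrt (z\<^sup>2 + (norm p)\<^sup>2) < 1" using t by (simp only: mult_less_cancel_left_pos)
          then show ?thesis by simp
        qed
        ultimately show ?thesis by blast
      qed
      then have "?S = ball 0 r" by auto
      then show ?thesis using 2 r0 r2 by (simp add: disc)
    next
      case False
      have "?S = {}"
      proof -
        have False if "t * sqrt (z\<^sup>2 + (norm p)\<^sup>2) < z" for p :: "real \<times> real"
        proof -
          have "z = sqrt (z\<^sup>2)" using 2 by simp
          also have "\<dots> \<le> sqrt (z\<^sup>2 + (norm p)\<^sup>2)" by (intro real_sqrt_le_mono) simp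
          also have "\<dots> \<le> t * sqrt (z\<^sup>2 + (norm p)\<^sup>2)"
            using False by (intro mult_right_mono[of 1 t, simplified]) auto
          finally show False using that by simp
        qed
        then show ?thesis by blast
      qed
      moreover have "z\<^sup>2 * (1 - t\<^sup>2) / t\<^sup>2 \<le> 0"
        using False t by (intro divide_nonpos_nonneg mult_nonneg_nonpos) auto
      then have "ennreal (pi * (z\<^sup>2 * (1 - t\<^sup>2) / t\<^sup>2)) = 0"
        by (intro ennreal_neg mult_nonneg_nonpos) auto
      ultimately show ?thesis using 2 by (simp only:) simp
    qed
  next
    case 3
    have "p \<in> ?S \<longleftrightarrow> norm p \<le> sqrt (1 - z\<^sup>2)" for p
    proof -
      have "t * sqrt (z\<^sup>2 + (norm p)\<^sup>2) < z" if "z\<^sup>2 + (norm p)\<^sup>2 \<le> 1"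
      proof -
        have "t * sqrt (z\<^sup>2 + (norm p)\<^sup>2) \<le> t * 1"
          using that assms by (intro mult_left_mono) auto
        then show ?thesis using 3 by simp
      qed
      moreover have "z\<^sup>2 + (norm p)\<^sup>2 \<le> 1 \<longleftrightarrow> norm p \<le> sqrt (1 - z\<^sup>2)"
        using real_le_rsqrt[of "norm p" "1 - z\<^sup>2"] 3
        by (auto simp: power_le_one algebra_simps dest: real_sqrt_ge_zero) 
           (smt (verit) norm_ge_zero power_le_one power_mono real_sqrt_pow2)
      ultimately show ?thesis by blast
    qed
    then have "?S = cball 0 (sqrt (1 - z\<^sup>2))" by auto
    then show ?thesis using 3 by (simp add: disc power_le_one)
  qed
qed

text \<open>
  Three times the volume of the solid cone over the cap.
\<close>

lemma emeasure_open_cap: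
  assumes "0 \<le> t" and "t \<le> 1"
  shows "emeasure \<sigma> {y \<in> sphere 0 1. y$3 > t} = ennreal (2 * pi * (1 - t))"
proof -
  let ?C = "{x :: real^3. norm x \<le> 1 \<and> t * norm x < x$3}"
  have C: "?C \<in> sets borel" by measurable
  have A: "{y \<in> sphere 0 1. y$3 > t} \<in> sets (restrict_space borel (sphere (0::real^3) 1))"
    by (subst sets_restrict_space_iff) (auto, measurable)
  have "{x \<in> cball 0 1 - {0}. x /\<^sub>R norm x \<in> {y \<in> sphere 0 1. y$3 > t}} = ?C"
    using assms by (auto simp: field_simps)
  then have "emeasure \<sigma> {y \<in> sphere 0 1. y$3 > t} = 3 * emeasure lborel ?C"
    using emeasure_sphere_borel_measure[OF A] by simp
  also have "emeasure lborel ?C = emeasure (lborel :: (real \<times> (real \<times> real)) measure)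
     {(z, p). z\<^sup>2 + (norm p)\<^sup>2 \<le> 1 \<and> t * sqrt (z\<^sup>2 + (norm p)\<^sup>2) < z}"
  proof -
    have "norm (vector [x, y, z] :: real^3) = sqrt (z\<^sup>2 + (norm (x, y))\<^sup>2)" for x y z :: real
      by (simp add: norm_eq_sqrt_inner inner_vec_def sum_3 power2_eq_square algebra_simps)
    then have "(\<lambda>(z, x, y). vector [x, y, z] :: real^3) -` ?C
        = {(z, p). z\<^sup>2 + (norm p)\<^sup>2 \<le> 1 \<and> t * sqrt (z\<^sup>2 + (norm p)\<^sup>2) < z}"
      by auto
    then show ?thesis
      using C measurable_vector_3 by (subst lborel_vec3_eq_distr) (simp add: emeasure_distr)
  qed
  also have "\<dots> = (\<integral>\<^sup>+z. emeasure lborel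
     {p :: real \<times> real. z\<^sup>2 + (norm p)\<^sup>2 \<le> 1 \<and> t * sqrt (z\<^sup>2 + (norm p)\<^sup>2) < z} \<partial>lborel)"
  proof -
    let ?S = "{(z, p). z\<^sup>2 + (norm p)\<^sup>2 \<le> 1 \<and> t * sqrt (z\<^sup>2 + (norm p)\<^sup>2) < z}
      :: (real \<times> (real \<times> real)) set"
    have "?S \<in> sets (borel :: (real \<times> (real \<times> real)) measure)"
    proof -
      have "?S = {p. (fst p)\<^sup>2 + (norm (snd p))\<^sup>2 \<le> 1}
          \<inter> {p. t * sqrt ((fst p)\<^sup>2 + (norm (snd p))\<^sup>2) < fst p}"
        by auto
      then show ?thesis
        by (simp only:) (intro sets.Int borel_closed borel_open closed_Collect_le open_Collect_less continuous_intros)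
    qed
    then have "?S \<in> sets (lborel \<Otimes>\<^sub>M lborel)"
      unfolding lborel_prod by simp
    from lborel.emeasure_pair_measure_alt[OF this] show ?thesis
      by (simp add: lborel_prod vimage_def)
  qed
  also have "\<dots> = (\<integral>\<^sup>+z. ennreal (pi * (z\<^sup>2 * (1 - t\<^sup>2) / t\<^sup>2)) * indicator {0..t} z
            + ennreal (pi * (1 - z\<^sup>2)) * indicator {t..1} z \<partial>lborel)"
  proof (rule nn_integral_cong_AE)
    have "AE z in lborel. z \<noteq> 0 \<and> z \<noteq> t"
      using AE_lborel_singleton[of 0] AE_lborel_singleton[of t] by eventually_elim auto
    then show "AE z in lborel. emeasure lborel
       {p :: real \<times> real. z\<^sup>2 + (norm p)\<^sup>2 \<le> 1 \<and> t * sqrt (z\<^sup>2 + (norm p)\<^sup>2) < z}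
      = ennreal (pi * (z\<^sup>2 * (1 - t\<^sup>2) / t\<^sup>2)) * indicator {0..t} z
            + ennreal (pi * (1 - z\<^sup>2)) * indicator {t..1} z"
      by eventually_elim (use polar_cone_slice_area assms in blast)
  qed
  also have "\<dots> = ennreal (2 * pi / 3 * (1 - t))"
    by (rule nn_integral_cone_profile[OF assms])
  also have "3 * \<dots> = ennreal (2 * pi * (1 - t))"
    using assms by (simp flip: ennreal_numeral ennreal_mult' add: ennreal_mult'[symmetric])
  finally show ?thesis .
qed

lemma measurable_nth3 [measurable]: "(\<lambda>y::real^3. y$i) \<in> borel_measurable borel"
  by (intro borel_measurable_continuous_onI continuous_intros)

lemma equator_null: "AE y in \<sigma>. y$3 \<noteq> 0"
proof -
  let ?Z = "{y \<in> sphere 0 1. y$3 = 0} :: (real^3) set"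
  have A: "?Z \<in> sets (restrict_space borel (sphere (0::real^3) 1))"
    by (subst sets_restrict_space_iff) (auto, measurable)
  have "{x :: real^3. x$3 = 0} \<in> null_sets lborel"
    using negligible_standard_hyperplane_cart[of "3::3"]
    by (simp add: negligible_iff_null_sets null_sets_completion_iff)
  moreover have "{x \<in> cball 0 1 - {0}. x /\<^sub>R norm x \<in> ?Z} \<subseteq> {x. x$3 = 0}"
    by auto
  ultimately have "emeasure lborel {x \<in> cball 0 1 - {0}. x /\<^sub>R norm x \<in> ?Z} = 0"
    by (metis (no_types, lifting) emeasure_mono le_zero_eq null_setsD1 null_setsD2)
  then have "emeasure \<sigma> ?Z = 0"
    using emeasure_sphere_borel_measure[OF A] by simp
  then show ?thesis
    using A by (intro AE_I[of _ _ ?Z]) auto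
qed

text \<open>
  Archimedes' theorem for the upper hemisphere. Lower heights never occur, because the largest zero of a
  Legendre polynomial of positive degree is nonnegative.
\<close>

lemma distr_sigma_height:
  "density (distr \<sigma> borel (\<lambda>y. y$3)) (\<lambda>t. ennreal (indicator {0<..} t))
     = density lborel (\<lambda>t. ennreal (2 * pi * indicator {0<..1} t))"
proof (rule measure_eqI_lessThan)
  have meas: "(\<lambda>y. y$3) \<in> borel_measurable \<sigma>"
    by (rule measurable_sigma) measurable
  have L: "emeasure (density (distr \<sigma> borel (\<lambda>y. y$3)) (\<lambda>t. ennreal (indicator {0<..} t))) {x<..}
      = (if max x 0 \<le> 1 then ennreal (2 * pi * (1 - max x 0)) else 0)" for x
  proof -
    have "emeasure (density (distr \<sigma> borel (\<lambda>y. y$3)) (\<lambda>t. ennreal (indicator {0<..} t))) {x<..}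
        = emeasure (distr \<sigma> borel (\<lambda>y. y$3)) {max x 0<..}"
      by (subst emeasure_density)
         (auto simp: nn_integral_indicator[symmetric] ennreal_indicator indicator_def simp del: nn_integral_indicator intro!: nn_integral_cong)
    also have "\<dots> = emeasure \<sigma> {y \<in> sphere 0 1. y$3 > max x 0}"
      using meas by (subst emeasure_distr) (auto intro!: arg_cong[where f = "emeasure \<sigma>"])
    also have "\<dots> = (if max x 0 \<le> 1 then ennreal (2 * pi * (1 - max x 0)) else 0)"
    proof (cases "max x 0 \<le> 1")
      case True
      then show ?thesis using emeasure_open_cap[of "max x 0"] by simp
    next
      case False
      have "{y \<in> sphere (0::real^3) 1. y$3 > max x 0} = {}"
      proof -
        have "y$3 \<le> 1" if "y \<in> sphere 0 1" for y :: "real^3"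
          using component_le_norm_cart[of y 3] that by simp
        then show ?thesis using False by force
      qed
      then show ?thesis using False by (simp only:) simp
    qed
    finally show ?thesis .
  qed
  show "emeasure (density (distr \<sigma> borel (\<lambda>y. y$3)) (\<lambda>t. ennreal (indicator {0<..} t))) {x<..} < \<infinity>" for x
    unfolding L by (simp add: ennreal_less_top)
  show "emeasure (density (distr \<sigma> borel (\<lambda>y. y$3)) (\<lambda>t. ennreal (indicator {0<..} t))) {x<..}
      = emeasure (density lborel (\<lambda>t. ennreal (2 * pi * indicator {0<..1} t))) {x<..}" for x
  proof -
    have "emeasure (density lborel (\<lambda>t. ennreal (2 * pi * indicator {0<..1} t))) {x<..}
        = (\<integral>\<^sup>+t. ennreal (2 * pi) * indicator {max x 0<..1} t \<partial>lborel)"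
      by (subst emeasure_density) (auto simp: indicator_def intro!: nn_integral_cong)
    also have "\<dots> = ennreal (2 * pi) * emeasure lborel {max x 0<..1}"
      by (rule nn_integral_cmult_indicator) simp
    also have "\<dots> = (if max x 0 \<le> 1 then ennreal (2 * pi * (1 - max x 0)) else 0)"
      by (auto simp: ennreal_mult not_le)
    finally show ?thesis unfolding L by simp
  qed
qed simp_all

lemma integral_sigma_zonal:
  fixes g :: "real \<Rightarrow> real"
  assumes g: "continuous_on UNIV g" and \<delta>: "0 \<le> \<delta>" "\<delta> \<le> 1"
  shows "(LINT y|\<sigma>. indicator {\<delta>..} (y$3) * g (y$3)) = 2 * pi * integral {\<delta>..1} g"
proof -
  have [measurable]: "g \<in> borel_measurable borel"
    by (rule borel_measurable_continuous_onI[OF g])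
  have meas: "(\<lambda>y. y$3) \<in> borel_measurable \<sigma>"
    by (rule measurable_sigma) measurable
  have "(LINT y|\<sigma>. indicator {\<delta>..} (y$3) * g (y$3))
      = (LINT y|\<sigma>. indicator {0<..} (y$3) * (indicator {\<delta>..} (y$3) * g (y$3)))"
  proof (rule integral_cong_AE)
    show "AE y in \<sigma>. indicator {\<delta>..} (y$3) * g (y$3)
        = indicator {0<..} (y$3) * (indicator {\<delta>..} (y$3) * g (y$3))"
      using equator_null by eventually_elim (use \<delta> in \<open>auto simp: indicator_def\<close>)
    show "(\<lambda>y. indicator {\<delta>..} (y$3) * g (y$3)) \<in> borel_measurable \<sigma>"
      by (rule measurable_sigma) measurable
    show "(\<lambda>y. indicator {0<..} (y$3) * (indicator {\<delta>..} (y$3) * g (y$3))) \<in> borel_measurable \<sigma>"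
      by (rule measurable_sigma) measurable
  qed
  also have "\<dots> = (LINT t|distr \<sigma> borel (\<lambda>y. y$3). indicator {0<..} t * (indicator {\<delta>..} t * g t))"
    using meas by (subst integral_distr) auto
  also have "\<dots> = (LINT t|density (distr \<sigma> borel (\<lambda>y. y$3)) (\<lambda>t. ennreal (indicator {0<..} t)).
      indicator {\<delta>..} t * g t)"
    by (subst integral_density) auto
  also have "\<dots> = (LINT t|lborel. (2 * pi * indicator {0<..1} t) * (indicator {\<delta>..} t * g t))"
    unfolding distr_sigma_height by (subst integral_density) auto
  also have "\<dots> = (LINT t|lborel. 2 * pi * (indicator {\<delta>..1} t * g t))"
  proof (rule integral_cong_AE)
    show "AE t in lborel. (2 * pi * indicator {0<..1} t) * (indicator {\<delta>..} t * g t)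
        = 2 * pi * (indicator {\<delta>..1} t * g t)"
      using AE_lborel_singleton[of "0::real"] by eventually_elim (use \<delta> in \<open>auto simp: indicator_def\<close>)
  qed measurable
  also have "\<dots> = 2 * pi * (LINT t:{\<delta>..1}|lborel. g t)"
    by (simp add: set_lebesgue_integral_def)
  also have "(LINT t:{\<delta>..1}|lborel. g t) = integral {\<delta>..1} g"
    by (intro set_borel_integral_eq_integral borel_integrable_atLeastAtMost')
       (rule continuous_on_subset[OF g], simp)
  finally show ?thesis .
qed

lemma integral_sigma_rotation:
  fixes f :: "real^3 \<Rightarrow> 'b::{banach, second_countable_topology}"
  assumes T: "orthogonal_transformation T" and f: "f \<in> borel_measurable borel"
  shows "(LINT x|\<sigma>. f (T x)) = (LINT x|\<sigma>. f x)"
proof -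
  have "(LINT x|\<sigma>. f x) = (LINT x|distr \<sigma> \<sigma> T. f x)"
    by (simp add: distr_sigma_rotation[OF T])
  also have "\<dots> = (LINT x|\<sigma>. f (T x))"
    by (intro integral_distr measurable_sigma_rotation[OF T] measurable_sigma f)
  finally show ?thesis by simp
qed

lemma integrable_sigma_bounded:
  fixes f :: "real^3 \<Rightarrow> 'b::{banach, second_countable_topology}"
  assumes "f \<in> borel_measurable borel" and "\<And>x. x \<in> sphere 0 1 \<Longrightarrow> norm (f x) \<le> B"
  shows "integrable \<sigma> f"
  by (rule finite_measure.integrable_const_bound[OF finite_measure_sigma, where B = B])
     (auto simp: assms measurable_sigma)

lemma continuous_bounded_on_sphere:
  fixes f :: "real^3 \<Rightarrow> 'b::real_normed_vector"
  assumes "continuous_on UNIV f"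
  obtains B where "B \<ge> 0" and "\<And>x. x \<in> sphere 0 1 \<Longrightarrow> norm (f x) \<le> B"
proof -
  have "compact (f ` sphere 0 1)"
    by (intro compact_continuous_image continuous_on_subset[OF assms]) auto
  then have "bounded (f ` sphere 0 1)" by (rule compact_imp_bounded)
  then obtain B where "B > 0" "\<And>y. y \<in> f ` sphere 0 1 \<Longrightarrow> norm y \<le> B"
    unfolding bounded_pos by blast
  then show ?thesis by (intro that[of B]) auto
qed

lemma rotation_of_pole:
  assumes "x \<in> sphere (0 :: real^3) 1"
  shows "\<exists>T :: real^3 \<Rightarrow> real^3. orthogonal_transformation T \<and> T (axis 3 1) = x \<and> (\<forall>y. x \<bullet> T y = y$3)"
proof -
  have "norm (axis 3 1 :: real^3) = norm x" using assms by simp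
  then obtain T where T: "orthogonal_transformation T" "T (axis 3 1 :: real^3) = x"
    by (rule orthogonal_transformation_exists)
  have "x \<bullet> T y = y$3" for y
  proof -
    have "T (axis 3 1) \<bullet> T y = axis 3 1 \<bullet> y"
      using T(1) by (simp add: orthogonal_transformation_def)
    then show ?thesis by (simp add: T(2) inner_axis')
  qed
  with T show ?thesis by blast
qed

lemma cap_in_sets: "spherical_cap \<delta> y \<in> sets \<sigma>"
proof -
  have eq: "spherical_cap \<delta> y = {z. y \<bullet> z \<ge> \<delta>} \<inter> sphere 0 1"
    by (auto simp: spherical_cap_def)
  have "spherical_cap \<delta> y \<in> sets borel"
    unfolding eq by (intro sets.Int borel_closed closed_Collect_le continuous_intros closed_sphere)
  then show ?thesis
    unfolding sets_sphere_borel_measure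
    by (subst sets_restrict_space_iff) (auto simp: spherical_cap_def)
qed

section \<open>The Funk--Hecke formula\<close>

lemma continuous_null_form: "continuous_on UNIV (null_form u v)"
proof -
  have "null_form u v = (\<lambda>x. of_real (u \<bullet> x) + \<i> * of_real (v \<bullet> x))"
    by (simp add: fun_eq_iff null_form_def Complex_eq)
  then show ?thesis by (simp only:) (intro continuous_intros)
qed

lemma measurable_kernel [measurable]:
  fixes h :: "real \<Rightarrow> 'b::topological_space"
  assumes "h \<in> borel_measurable borel"
  shows "(\<lambda>y::real^3. h (x \<bullet> y)) \<in> borel_measurable borel"
  using assms by measurable

text \<open>
  The kernel is invariant under rotations about the axis, so the power may be replaced by its average
  over these rotations.
\<close>

lemma funk_hecke_pole:
  fixes h :: "real \<Rightarrow> real"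
  assumes uv: "null_pair u v" and h: "h \<in> borel_measurable borel" and B: "\<And>t. \<bar>h t\<bar> \<le> B"
  shows "(LINT y|\<sigma>. of_real (h (y$3)) * null_form u v y ^ l)
     = of_real (LINT y|\<sigma>. h (y$3) * poly (legendre l) (y$3)) * null_form u v (axis 3 1) ^ l"
proof -
  note [measurable] = h
  have mE [measurable]: "null_form u v \<in> borel_measurable borel" for u v
    by (rule borel_measurable_continuous_onI[OF continuous_null_form])
  have mrot: "rotation3 \<theta> \<in> borel_measurable borel" for \<theta>
    by (intro borel_measurable_continuous_onI linear_continuous_on)
       (use orthogonal_transformation_linear[OF orthogonal_transformation_rotation3] linear_conv_bounded_linear in blast)
  \<comment> \<open>More nodes than the degree, so that the average over \<open>N\<close> rotations is exact.\<close>
  define N where "N = l + 1"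
  define \<theta> where "\<theta> = (\<lambda>j. 2 * pi * real j / real N)"
  define I where "I = (LINT y|\<sigma>. of_real (h (y$3)) * null_form u v y ^ l)"
  obtain K where K: "\<And>x. x \<in> sphere 0 1 \<Longrightarrow> norm (null_form u v x) \<le> K"
    using continuous_bounded_on_sphere[OF continuous_null_form] by metis
  have B0: "B \<ge> 0" using B[of 0] by linarith
  have rot: "(LINT y|\<sigma>. of_real (h (y$3)) * null_form u v (rotation3 t y) ^ l) = I" for t
    using integral_sigma_rotation[OF orthogonal_transformation_rotation3[of t],
        of "\<lambda>y. of_real (h (y$3)) * null_form u v y ^ l"]
    unfolding I_def by (simp add: rotation3_def)
  have integ: "integrable \<sigma> (\<lambda>y. complex_of_real (h (y$3)) * null_form u v (rotation3 t y) ^ l)" for t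
  proof (rule integrable_sigma_bounded)
    show "(\<lambda>y. complex_of_real (h (y$3)) * null_form u v (rotation3 t y) ^ l) \<in> borel_measurable borel"
      using mrot measurable_compose[OF mrot mE] by measurable
    fix x :: "real^3" assume "x \<in> sphere 0 1"
    then have "rotation3 t x \<in> sphere 0 1"
      using orthogonal_transformation_norm[OF orthogonal_transformation_rotation3[of t], of x] by simp
    then have "norm (null_form u v (rotation3 t x) ^ l) \<le> K ^ l"
      unfolding norm_power by (intro power_mono K) auto
    then show "norm (complex_of_real (h (x$3)) * null_form u v (rotation3 t x) ^ l) \<le> B * K ^ l"
      unfolding norm_mult by (intro mult_mono B0) (auto simp: B)
  qed
  have "of_nat N * I = (\<Sum>j<N. LINT y|\<sigma>. of_real (h (y$3)) * null_form u v (rotation3 (\<theta> j) y) ^ l)"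
    unfolding rot by simp
  also have "\<dots> = (LINT y|\<sigma>. (\<Sum>j<N. of_real (h (y$3)) * null_form u v (rotation3 (\<theta> j) y) ^ l))"
    by (rule Bochner_Integration.integral_sum[symmetric]) (rule integ)
  also have "\<dots> = (LINT y|\<sigma>. (of_nat N * null_form u v (axis 3 1) ^ l) *
      of_real (h (y$3) * poly (legendre l) (y$3)))"
  proof (rule Bochner_Integration.integral_cong[OF refl])
    fix y assume "y \<in> space \<sigma>"
    then have "norm y = 1" by simp
    then have "(\<Sum>j<N. null_form u v (rotation3 (\<theta> j) y) ^ l)
        = of_nat N * (of_real (poly (legendre l) (y$3)) * null_form u v (axis 3 1) ^ l)"
      unfolding \<theta>_def by (intro average_null_form_power[OF uv]) (auto simp: N_def)
    then show "(\<Sum>j<N. of_real (h (y$3)) * null_form u v (rotation3 (\<theta> j) y) ^ l)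
        = (of_nat N * null_form u v (axis 3 1) ^ l) * of_real (h (y$3) * poly (legendre l) (y$3))"
      by (simp add: mult_ac flip: sum_distrib_left)
  qed
  also have "\<dots> = (of_nat N * null_form u v (axis 3 1) ^ l) *
      of_real (LINT y|\<sigma>. h (y$3) * poly (legendre l) (y$3))"
    by (simp only: integral_mult_right_zero integral_complex_of_real)
  finally show ?thesis
    unfolding I_def by (simp add: N_def mult_ac del: of_nat_add of_nat_Suc)
qed

lemma funk_hecke:
  fixes h :: "real \<Rightarrow> real"
  assumes uv: "null_pair u v" and h: "h \<in> borel_measurable borel" and B: "\<And>t. \<bar>h t\<bar> \<le> B"
    and x: "x \<in> sphere 0 1"
  shows "(LINT y|\<sigma>. of_real (h (x \<bullet> y)) * null_form u v y ^ l)
     = of_real (LINT y|\<sigma>. h (y$3) * poly (legendre l) (y$3)) * null_form u v x ^ l"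
proof -
  note [measurable] = h
  have [measurable]: "null_form u v \<in> borel_measurable borel" for u v
    by (rule borel_measurable_continuous_onI[OF continuous_null_form])
  obtain T :: "real^3 \<Rightarrow> real^3" where T: "orthogonal_transformation T" "T (axis 3 1) = x" and height: "\<And>y. x \<bullet> T y = y$3"
    using rotation_of_pole[OF x] by blast
  define S where "S = inv T"
  have S: "u \<bullet> T y = S u \<bullet> y" for u y
  proof -
    have "T (S u) = u"
      unfolding S_def using orthogonal_transformation_bij[OF T(1)] by (simp add: bij_is_surj surj_f_inv_f)
    then show ?thesis
      using T(1) by (metis orthogonal_transformation_def)
  qed
  have Sip: "S u \<bullet> S v = u \<bullet> v" for u v
    using orthogonal_transformation_inv[OF T(1)] unfolding S_def orthogonal_transformation_def by blast
  have form: "null_form u v (T y) = null_form (S u) (S v) y" for y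
    by (simp add: null_form_def S)
  have uv': "null_pair (S u) (S v)"
    using uv by (simp add: null_pair_def Sip)
  have "(LINT y|\<sigma>. of_real (h (x \<bullet> y)) * null_form u v y ^ l)
      = (LINT y|\<sigma>. of_real (h (x \<bullet> T y)) * null_form u v (T y) ^ l)"
    by (rule integral_sigma_rotation[OF T(1), symmetric]) measurable
  also have "\<dots> = of_real (LINT y|\<sigma>. h (y$3) * poly (legendre l) (y$3)) * null_form u v x ^ l"
    using form[of "axis 3 1"] by (simp only: form height funk_hecke_pole[OF uv' h B] T(2))
  finally show ?thesis .
qed

section \<open>The large sieve for a zonal kernel\<close>

interpretation sigma: finite_measure \<sigma>
  by (rule finite_measure_sigma)

interpretation sigma_pair: pair_sigma_finite \<sigma> \<sigma> ..

lemma id_measurable_sigma [measurable]: "(\<lambda>x. x) \<in> \<sigma> \<rightarrow>\<^sub>M borel"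
  by (rule measurable_sigma) simp

text \<open>
  From $\int (C |u| - U |v|)^2 \<ge> 0$ with $U = \int u^2$ and $C = \int |u v|$.
\<close>

lemma Cauchy_Schwarz_sigma:
  fixes u :: "real^3 \<Rightarrow> real" and v :: "real^3 \<Rightarrow> complex"
  assumes u: "u \<in> borel_measurable borel" "\<And>x. x \<in> sphere 0 1 \<Longrightarrow> \<bar>u x\<bar> \<le> A"
    and v: "v \<in> borel_measurable borel" "\<And>x. x \<in> sphere 0 1 \<Longrightarrow> cmod (v x) \<le> B"
    and pos: "(LINT y|\<sigma>. (u y)\<^sup>2) > 0"
  shows "(cmod (LINT y|\<sigma>. of_real (u y) * v y))\<^sup>2
     \<le> (LINT y|\<sigma>. (u y)\<^sup>2) * (LINT y|\<sigma>. (cmod (v y))\<^sup>2)"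
proof -
  note [measurable] = u(1) v(1)
  let ?u = "\<lambda>y. \<bar>u y\<bar>" and ?v = "\<lambda>y. cmod (v y)"
  have A: "0 \<le> A" using u(2)[of "axis 1 1"] by simp
  have B: "0 \<le> B" using order_trans[OF norm_ge_zero v(2)[of "axis 1 1"]] by simp
  have iuv: "integrable \<sigma> (\<lambda>y. ?u y * ?v y)"
    by (rule integrable_sigma_bounded[where B = "A * B"])
       (measurable, auto simp: abs_mult intro!: mult_mono A B u v)
  have iu: "integrable \<sigma> (\<lambda>y. (u y)\<^sup>2)"
    by (rule integrable_sigma_bounded[where B = "A\<^sup>2"])
       (measurable, auto intro!: power2_le_iff_abs_le[THEN iffD2] simp: A u)
  have iv: "integrable \<sigma> (\<lambda>y. (?v y)\<^sup>2)"
    by (rule integrable_sigma_bounded[where B = "B\<^sup>2"])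
       (measurable, auto intro!: power_mono simp: B v)
  define U where "U = (LINT y|\<sigma>. (u y)\<^sup>2)"
  define V where "V = (LINT y|\<sigma>. (?v y)\<^sup>2)"
  define C where "C = (LINT y|\<sigma>. ?u y * ?v y)"
  have "0 \<le> (LINT y|\<sigma>. (C * ?u y - U * ?v y)\<^sup>2)"
    by (rule integral_nonneg_AE) simp
  also have "\<dots> = (LINT y|\<sigma>. C\<^sup>2 * (u y)\<^sup>2 - 2 * C * U * (?u y * ?v y) + U\<^sup>2 * (?v y)\<^sup>2)"
    by (rule Bochner_Integration.integral_cong[OF refl]) (simp add: power2_diff power_mult_distrib algebra_simps)
  also have "\<dots> = C\<^sup>2 * U - 2 * C * U * C + U\<^sup>2 * V"
    unfolding U_def V_def C_def using iuv iu iv by simp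
  also have "\<dots> = U * (U * V - C\<^sup>2)"
    by (simp add: algebra_simps power2_eq_square)
  finally have "C\<^sup>2 \<le> U * V"
    using pos unfolding U_def[symmetric] by (simp add: zero_le_mult_iff)
  moreover have "cmod (LINT y|\<sigma>. of_real (u y) * v y) \<le> C"
    unfolding C_def using integral_norm_bound[of \<sigma> "\<lambda>y. of_real (u y) * v y"]
    by (simp add: norm_mult)
  then have "(cmod (LINT y|\<sigma>. of_real (u y) * v y))\<^sup>2 \<le> C\<^sup>2"
    by (intro power_mono) auto
  ultimately show ?thesis unfolding U_def V_def by linarith
qed

text \<open>
  The kernel $h(\<langle>x, y\<rangle>)$ is real and symmetric, so the operator is self-adjoint and eigenfunctions to
  distinct eigenvalues are orthogonal. Orthogonality of different degrees thus comes from the sieve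
  kernel itself, once its eigenvalues are distinct.
\<close>

lemma zonal_eigenfunctions_orthogonal:
  fixes h :: "real \<Rightarrow> real" and F G :: "real^3 \<Rightarrow> complex" and a b :: real
  assumes h: "h \<in> borel_measurable borel" and B: "\<And>t. \<bar>h t\<bar> \<le> B"
    and F: "continuous_on UNIV F" and G: "continuous_on UNIV G"
    and eF: "\<And>x. x \<in> sphere 0 1 \<Longrightarrow> (LINT y|\<sigma>. of_real (h (x \<bullet> y)) * F y) = of_real a * F x"
    and eG: "\<And>x. x \<in> sphere 0 1 \<Longrightarrow> (LINT y|\<sigma>. of_real (h (x \<bullet> y)) * G y) = of_real b * G x"
    and ab: "a \<noteq> b"
  shows "(LINT x|\<sigma>. F x * cnj (G x)) = 0"
proof -
  note [measurable] = h borel_measurable_continuous_onI[OF F] borel_measurable_continuous_onI[OF G]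
  obtain KF where KF: "\<And>x. x \<in> sphere 0 1 \<Longrightarrow> norm (F x) \<le> KF"
    using continuous_bounded_on_sphere[OF F] by metis
  obtain KG where KG: "\<And>x. x \<in> sphere 0 1 \<Longrightarrow> norm (G x) \<le> KG"
    using continuous_bounded_on_sphere[OF G] by metis
  have B0: "0 \<le> B" using B[of 0] by linarith
  define k where "k = (\<lambda>x y. complex_of_real (h (x \<bullet> y)) * F y * cnj (G x))"
  have fst_m: "(\<lambda>p. fst p) \<in> \<sigma> \<Otimes>\<^sub>M \<sigma> \<rightarrow>\<^sub>M (borel :: (real^3) measure)"
    by (rule measurable_compose[OF measurable_fst id_measurable_sigma])
  have snd_m: "(\<lambda>p. snd p) \<in> \<sigma> \<Otimes>\<^sub>M \<sigma> \<rightarrow>\<^sub>M (borel :: (real^3) measure)"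
    by (rule measurable_compose[OF measurable_snd id_measurable_sigma])
  have fin: "finite_measure (\<sigma> \<Otimes>\<^sub>M \<sigma>)"
    by (rule finite_measure_pair_measure) unfold_locales
  have "integrable (\<sigma> \<Otimes>\<^sub>M \<sigma>) (\<lambda>p. k (fst p) (snd p))"
  proof (rule finite_measure.integrable_const_bound[OF fin, where B = "B * KF * KG"])
    show "AE p in \<sigma> \<Otimes>\<^sub>M \<sigma>. norm (k (fst p) (snd p)) \<le> B * KF * KG"
    proof (rule AE_I2)
      fix p assume "p \<in> space (\<sigma> \<Otimes>\<^sub>M \<sigma>)"
      then have p: "fst p \<in> sphere 0 1" "snd p \<in> sphere 0 1"
        by (auto simp: space_pair_measure)
      have "KF \<ge> 0" "KG \<ge> 0"
        using KF[OF p(1)] KG[OF p(1)] norm_ge_zero order_trans by blast+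
      then show "norm (k (fst p) (snd p)) \<le> B * KF * KG"
        unfolding k_def norm_mult complex_mod_cnj norm_of_real
        by (intro mult_mono mult_nonneg_nonneg B KF KG p B0) auto
    qed
    show "(\<lambda>p. k (fst p) (snd p)) \<in> borel_measurable (\<sigma> \<Otimes>\<^sub>M \<sigma>)"
      unfolding k_def
      by (intro borel_measurable_times
          measurable_compose[OF measurable_compose[OF borel_measurable_inner[OF fst_m snd_m] h]
            borel_measurable_of_real]
          measurable_compose[OF snd_m borel_measurable_continuous_onI[OF F]]
          measurable_compose[OF fst_m borel_measurable_continuous_onI[OF continuous_on_cnj[OF G]]])
  qed
  then have "integrable (\<sigma> \<Otimes>\<^sub>M \<sigma>) (case_prod k)"
    by (simp add: case_prod_beta')
  from sigma_pair.Fubini_integral[OF this]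
  have swap: "(LINT y|\<sigma>. LINT x|\<sigma>. k x y) = (LINT x|\<sigma>. LINT y|\<sigma>. k x y)" .
  have "(LINT x|\<sigma>. LINT y|\<sigma>. k x y) = (LINT x|\<sigma>. of_real a * (F x * cnj (G x)))"
  proof (rule Bochner_Integration.integral_cong[OF refl])
    fix x assume "x \<in> space \<sigma>"
    then have x: "x \<in> sphere 0 1" by simp
    have "(LINT y|\<sigma>. k x y) = (LINT y|\<sigma>. of_real (h (x \<bullet> y)) * F y) * cnj (G x)"
      unfolding k_def by (rule integral_mult_left_zero)
    then show "(LINT y|\<sigma>. k x y) = of_real a * (F x * cnj (G x))"
      by (simp add: eF[OF x])
  qed
  moreover have "(LINT y|\<sigma>. LINT x|\<sigma>. k x y) = (LINT y|\<sigma>. of_real b * (F y * cnj (G y)))"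
  proof (rule Bochner_Integration.integral_cong[OF refl])
    fix y assume "y \<in> space \<sigma>"
    then have y: "y \<in> sphere 0 1" by simp
    have "(LINT x|\<sigma>. k x y) = (LINT x|\<sigma>. F y * cnj (of_real (h (y \<bullet> x)) * G x))"
      unfolding k_def by (simp add: inner_commute mult_ac)
    also have "\<dots> = F y * cnj (LINT x|\<sigma>. of_real (h (y \<bullet> x)) * G x)"
      by (simp only: integral_mult_right_zero Bochner_Integration.integral_cnj)
    finally show "(LINT x|\<sigma>. k x y) = of_real b * (F y * cnj (G y))"
      by (simp add: eG[OF y])
  qed
  ultimately have "of_real a * (LINT x|\<sigma>. F x * cnj (G x)) = of_real b * (LINT x|\<sigma>. F x * cnj (G x))"
    using swap by simp
  then show ?thesis using ab by simp
qed

lemma integral_norm_square_orthogonal_sum: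
  fixes F :: "nat \<Rightarrow> real^3 \<Rightarrow> complex" and c :: "nat \<Rightarrow> real"
  assumes F: "\<And>l. l \<le> L \<Longrightarrow> continuous_on UNIV (F l)"
    and orth: "\<And>l k. l \<le> L \<Longrightarrow> k \<le> L \<Longrightarrow> l \<noteq> k \<Longrightarrow> (LINT x|\<sigma>. F l x * cnj (F k x)) = 0"
  shows "(LINT x|\<sigma>. (cmod (\<Sum>l\<le>L. of_real (c l) * F l x))\<^sup>2)
     = (\<Sum>l\<le>L. (c l)\<^sup>2 * (LINT x|\<sigma>. (cmod (F l x))\<^sup>2))"
proof -
  have int: "integrable \<sigma> (\<lambda>x. F l x * cnj (F k x))" if "l \<le> L" "k \<le> L" for l k
  proof -
    have cont: "continuous_on UNIV (\<lambda>x. F l x * cnj (F k x))"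
      by (intro continuous_intros F that)
    then obtain K where "\<And>x. x \<in> sphere 0 1 \<Longrightarrow> norm (F l x * cnj (F k x)) \<le> K"
      using continuous_bounded_on_sphere[OF cont] by metis
    then show ?thesis
      by (rule integrable_sigma_bounded[OF borel_measurable_continuous_onI[OF cont]])
  qed
  have "complex_of_real (LINT x|\<sigma>. (cmod (\<Sum>l\<le>L. of_real (c l) * F l x))\<^sup>2)
      = (LINT x|\<sigma>. of_real ((cmod (\<Sum>l\<le>L. of_real (c l) * F l x))\<^sup>2))"
    by (simp only: integral_complex_of_real)
  also have "\<dots> = (LINT x|\<sigma>. (\<Sum>l\<le>L. \<Sum>k\<le>L. of_real (c l * c k) * (F l x * cnj (F k x))))"
    by (rule Bochner_Integration.integral_cong[OF refl])
       (simp only: complex_norm_square cnj_sum complex_cnj_mult complex_cnj_complex_of_real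
          sum_product of_real_mult mult_ac)
  also have "\<dots> = (\<Sum>l\<le>L. \<Sum>k\<le>L. of_real (c l * c k) * (LINT x|\<sigma>. F l x * cnj (F k x)))"
  proof -
    have int': "integrable \<sigma> (\<lambda>x. of_real (c l * c k) * (F l x * cnj (F k x)))"
      if "l \<in> {..L}" "k \<in> {..L}" for l k
      using int that by (intro integrable_mult_right) auto
    have "(LINT x|\<sigma>. (\<Sum>k\<le>L. of_real (c l * c k) * (F l x * cnj (F k x))))
        = (\<Sum>k\<le>L. of_real (c l * c k) * (LINT x|\<sigma>. F l x * cnj (F k x)))" if "l \<in> {..L}" for l
      by (subst Bochner_Integration.integral_sum[OF int'[OF that]]) (simp_all only: integral_mult_right_zero)
    then show ?thesis
      by (subst Bochner_Integration.integral_sum)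
         (auto intro!: Bochner_Integration.integrable_sum int' sum.cong simp del: of_real_mult)
  qed
  also have "\<dots> = (\<Sum>l\<le>L. \<Sum>k\<le>L. if k = l then of_real ((c l)\<^sup>2 * (LINT x|\<sigma>. (cmod (F l x))\<^sup>2)) else 0)"
  proof (intro sum.cong refl)
    fix l k assume "l \<in> {..L}" "k \<in> {..L}"
    moreover have "(LINT x|\<sigma>. F l x * cnj (F l x)) = of_real (LINT x|\<sigma>. (cmod (F l x))\<^sup>2)" for l
      by (simp only: integral_complex_of_real[symmetric] complex_norm_square)
    ultimately show "of_real (c l * c k) * (LINT x|\<sigma>. F l x * cnj (F k x))
      = (if k = l then of_real ((c l)\<^sup>2 * (LINT x|\<sigma>. (cmod (F l x))\<^sup>2)) else 0)"
      using orth[of l k] by (auto simp: power2_eq_square)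
  qed
  also have "\<dots> = of_real (\<Sum>l\<le>L. (c l)\<^sup>2 * (LINT x|\<sigma>. (cmod (F l x))\<^sup>2))"
    by simp
  finally show ?thesis by (simp only: of_real_eq_iff)
qed

text \<open>
  The sieve argument for an arbitrary zonal kernel supported on caps: with $f = \sum_l F_l$ and
  $g = \sum_l F_l / \<kappa>_l$ one has $f(x) = \int h(\<langle>x, y\<rangle>) g(y) d\<sigma>(y)$; Cauchy--Schwarz, Tonelli for
  $\<mu> \<otimes> \<sigma>$ and $\|g\| \<le> \|f\| / b$ give the bound. As the estimates are carried out with extended
  nonnegative integrals, a supremum equal to $\<infinity>$ is covered with the convention $0 \<cdot> \<infinity> = 0$.
\<close>

lemma zonal_large_sieve:
  fixes h :: "real \<Rightarrow> real" and F :: "nat \<Rightarrow> real^3 \<Rightarrow> complex" and \<kappa> :: "nat \<Rightarrow> real"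
  assumes \<mu>: "sets \<mu> = sets (restrict_space borel (sphere (0::real^3) 1))" "sigma_finite_measure \<mu>"
    and h: "h \<in> borel_measurable borel" and B: "\<And>t. \<bar>h t\<bar> \<le> B" and supp: "\<And>t. t < \<delta> \<Longrightarrow> h t = 0"
    and F: "\<And>l. l \<le> L \<Longrightarrow> continuous_on UNIV (F l)"
    and eig: "\<And>l x. l \<le> L \<Longrightarrow> x \<in> sphere 0 1 \<Longrightarrow>
        (LINT y|\<sigma>. of_real (h (x \<bullet> y)) * F l y) = of_real (\<kappa> l) * F l x"
    and dist: "inj_on \<kappa> {..L}" and min: "\<And>l. l \<le> L \<Longrightarrow> b \<le> \<kappa> l" and b: "b > 0"
    and hpos: "(LINT y|\<sigma>. (h (y$3))\<^sup>2) > 0"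
  shows "(\<integral>\<^sup>+x. ennreal ((cmod (\<Sum>l\<le>L. F l x))\<^sup>2) \<partial>\<mu>)
     \<le> ennreal ((LINT y|\<sigma>. (h (y$3))\<^sup>2) / b\<^sup>2 * (LINT x|\<sigma>. (cmod (\<Sum>l\<le>L. F l x))\<^sup>2))
        * (SUP y\<in>sphere 0 1. emeasure \<mu> (spherical_cap \<delta> y))"
proof -
  interpret \<mu>: sigma_finite_measure \<mu> by fact
  interpret \<mu>\<sigma>: pair_sigma_finite \<mu> \<sigma> ..
  have space: "space \<mu> = sphere 0 1"
    using sets_eq_imp_space_eq[OF \<mu>(1)] by (simp add: space_restrict_space)
  define A where "A = (LINT y|\<sigma>. (h (y$3))\<^sup>2)"
  define S where "S = (SUP y\<in>sphere 0 1. emeasure \<mu> (spherical_cap \<delta> y))"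
  define f where "f = (\<lambda>x. \<Sum>l\<le>L. F l x)"
  define g where "g = (\<lambda>x. \<Sum>l\<le>L. of_real (1 / \<kappa> l) * F l x)"
  define P where "P = (\<lambda>p :: (real^3) \<times> (real^3). ennreal ((cmod (g (snd p)))\<^sup>2) * indicator {t. \<delta> \<le> t} (fst p \<bullet> snd p))"
  have \<kappa>pos: "\<kappa> l > 0" if "l \<le> L" for l using min[OF that] b by simp
  have cont_g: "continuous_on UNIV g"
    unfolding g_def by (intro continuous_intros F) auto
  have g_m: "g \<in> borel_measurable borel" by (rule borel_measurable_continuous_onI[OF cont_g])
  obtain K where K: "\<And>x. x \<in> sphere 0 1 \<Longrightarrow> norm (g x) \<le> K"
    using continuous_bounded_on_sphere[OF cont_g] by metis
  have A_rot: "(LINT y|\<sigma>. (h (x \<bullet> y))\<^sup>2) = A" if x: "x \<in> sphere 0 1" for x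
  proof -
    obtain T :: "real^3 \<Rightarrow> real^3" where T: "orthogonal_transformation T" and height: "\<And>y. x \<bullet> T y = y$3"
      using rotation_of_pole[OF x] by blast
    have "(LINT y|\<sigma>. (h (x \<bullet> y))\<^sup>2) = (LINT y|\<sigma>. (h (x \<bullet> T y))\<^sup>2)"
      using h by (intro integral_sigma_rotation[OF T, symmetric]) measurable
    then show ?thesis unfolding height A_def .
  qed
  have reproduce: "f x = (LINT y|\<sigma>. of_real (h (x \<bullet> y)) * g y)" if x: "x \<in> sphere 0 1" for x
  proof -
    have int: "integrable \<sigma> (\<lambda>y. of_real (h (x \<bullet> y)) * F l y)" if l: "l \<le> L" for l
    proof -
      obtain C where C: "\<And>x. x \<in> sphere 0 1 \<Longrightarrow> norm (F l x) \<le> C"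
        using continuous_bounded_on_sphere[OF F[OF l]] by metis
      have B0: "0 \<le> B" using B[of 0] by linarith
      show ?thesis
      proof (rule integrable_sigma_bounded)
        show "(\<lambda>y. of_real (h (x \<bullet> y)) * F l y) \<in> borel_measurable borel"
          using h borel_measurable_continuous_onI[OF F[OF l]] by measurable
        show "norm (of_real (h (x \<bullet> y)) * F l y) \<le> B * C" if "y \<in> sphere 0 1" for y
          unfolding norm_mult using B C[OF that(1)] B0 by (intro mult_mono) auto
      qed
    qed
    have "(LINT y|\<sigma>. of_real (h (x \<bullet> y)) * g y)
        = (LINT y|\<sigma>. (\<Sum>l\<le>L. of_real (1 / \<kappa> l) * (of_real (h (x \<bullet> y)) * F l y)))"
      unfolding g_def sum_distrib_left by (simp only: mult.left_commute)
    also have "\<dots> = (\<Sum>l\<le>L. LINT y|\<sigma>. of_real (1 / \<kappa> l) * (of_real (h (x \<bullet> y)) * F l y))"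
      by (rule Bochner_Integration.integral_sum) (intro integrable_mult_right int, simp)
    also have "\<dots> = (\<Sum>l\<le>L. F l x)"
    proof (intro sum.cong refl)
      fix l assume "l \<in> {..L}"
      then have l: "l \<le> L" by simp
      have "(LINT y|\<sigma>. of_real (1 / \<kappa> l) * (of_real (h (x \<bullet> y)) * F l y))
          = of_real (1 / \<kappa> l) * (of_real (\<kappa> l) * F l x)"
        by (simp only: integral_mult_right_zero eig[OF l x])
      then show "(LINT y|\<sigma>. of_real (1 / \<kappa> l) * (of_real (h (x \<bullet> y)) * F l y)) = F l x"
        using \<kappa>pos[OF l] by simp
    qed
    finally show ?thesis unfolding f_def by simp
  qed
  have pointwise: "ennreal ((cmod (f x))\<^sup>2) \<le> ennreal A * (\<integral>\<^sup>+y. P (x, y) \<partial>\<sigma>)"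
    if x: "x \<in> sphere 0 1" for x
  proof -
    define v where "v = (\<lambda>y. of_real (indicator {t. \<delta> \<le> t} (x \<bullet> y)) * g y)"
    have v_m: "v \<in> borel_measurable borel"
      unfolding v_def using g_m by measurable
    have vK: "norm (v y) \<le> K" if "y \<in> sphere 0 1" for y
      using K[OF that] order_trans[OF norm_ge_zero K[OF that]] by (auto simp: v_def norm_mult indicator_def)
    have hx_m: "(\<lambda>y. h (x \<bullet> y)) \<in> borel_measurable borel" using h by measurable
    have "f x = (LINT y|\<sigma>. of_real (h (x \<bullet> y)) * v y)"
      unfolding reproduce[OF x] v_def
      by (rule Bochner_Integration.integral_cong[OF refl]) (use supp in \<open>auto simp: indicator_def\<close>)
    then have "(cmod (f x))\<^sup>2 \<le> A * (LINT y|\<sigma>. (cmod (v y))\<^sup>2)"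
      using Cauchy_Schwarz_sigma[OF hx_m B v_m vK] hpos
      by (simp add: A_rot[OF x] A_def[symmetric])
    also have "ennreal \<dots> = ennreal A * ennreal (LINT y|\<sigma>. (cmod (v y))\<^sup>2)"
      by (intro ennreal_mult' ) (use hpos in \<open>simp add: A_def\<close>)
    also have "ennreal (LINT y|\<sigma>. (cmod (v y))\<^sup>2) = (\<integral>\<^sup>+y. ennreal ((cmod (v y))\<^sup>2) \<partial>\<sigma>)"
    proof (rule nn_integral_eq_integral[symmetric])
      show "integrable \<sigma> (\<lambda>y. (cmod (v y))\<^sup>2)"
        by (rule integrable_sigma_bounded[where B = "K\<^sup>2"])
           (use v_m in measurable, auto intro!: power_mono vK)
    qed simp
    also have "\<dots> = (\<integral>\<^sup>+y. P (x, y) \<partial>\<sigma>)"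
      by (rule nn_integral_cong) (auto simp: v_def P_def norm_mult indicator_def)
    finally show ?thesis by (simp add: ennreal_leI)
  qed
  have id_\<mu>: "(\<lambda>x. x) \<in> \<mu> \<rightarrow>\<^sub>M borel"
    by (subst measurable_cong_sets[OF \<mu>(1) refl]) (rule measurable_restrict_space1, simp)
  have P_m: "P \<in> borel_measurable (\<mu> \<Otimes>\<^sub>M \<sigma>)"
  proof -
    have f: "fst \<in> \<mu> \<Otimes>\<^sub>M \<sigma> \<rightarrow>\<^sub>M (borel :: (real^3) measure)"
      by (rule measurable_compose[OF measurable_fst id_\<mu>])
    have s: "snd \<in> \<mu> \<Otimes>\<^sub>M \<sigma> \<rightarrow>\<^sub>M (borel :: (real^3) measure)"
      by (rule measurable_compose[OF measurable_snd id_measurable_sigma])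
    have "(\<lambda>x. ennreal ((cmod (g x))\<^sup>2)) \<in> borel_measurable borel" using g_m by measurable
    moreover have "indicator {t::real. \<delta> \<le> t} \<in> borel_measurable borel" by measurable
    ultimately show ?thesis
      unfolding P_def
      by (intro borel_measurable_times_ennreal
          measurable_compose[OF s, of "\<lambda>x. ennreal ((cmod (g x))\<^sup>2)"]
          measurable_compose[OF borel_measurable_inner[OF f s], of "indicator {t. \<delta> \<le> t}"])
  qed
  have "(\<integral>\<^sup>+x. ennreal ((cmod (f x))\<^sup>2) \<partial>\<mu>) \<le> (\<integral>\<^sup>+x. ennreal A * (\<integral>\<^sup>+y. P (x, y) \<partial>\<sigma>) \<partial>\<mu>)"
    by (rule nn_integral_mono) (simp add: pointwise space)
  also have "\<dots> = ennreal A * (\<integral>\<^sup>+x. (\<integral>\<^sup>+y. P (x, y) \<partial>\<sigma>) \<partial>\<mu>)"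
    by (rule nn_integral_cmult) (rule sigma.borel_measurable_nn_integral_fst[OF P_m])
  also have "(\<integral>\<^sup>+x. (\<integral>\<^sup>+y. P (x, y) \<partial>\<sigma>) \<partial>\<mu>) = (\<integral>\<^sup>+y. (\<integral>\<^sup>+x. P (x, y) \<partial>\<mu>) \<partial>\<sigma>)"
    by (rule \<mu>\<sigma>.Fubini[OF P_m, symmetric])
  also have "\<dots> \<le> (\<integral>\<^sup>+y. ennreal ((cmod (g y))\<^sup>2) * S \<partial>\<sigma>)"
  proof (rule nn_integral_mono)
    fix y assume "y \<in> space \<sigma>"
    then have y: "y \<in> sphere 0 1" by simp
    have cap: "spherical_cap \<delta> y \<in> sets \<mu>"
      using cap_in_sets[of \<delta> y] unfolding \<mu>(1) by simp
    have "(\<integral>\<^sup>+x. P (x, y) \<partial>\<mu>)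
        = (\<integral>\<^sup>+x. ennreal ((cmod (g y))\<^sup>2) * indicator (spherical_cap \<delta> y) x \<partial>\<mu>)"
      by (rule nn_integral_cong) (auto simp: P_def space spherical_cap_def indicator_def inner_commute)
    also have "\<dots> = ennreal ((cmod (g y))\<^sup>2) * emeasure \<mu> (spherical_cap \<delta> y)"
      by (rule nn_integral_cmult_indicator[OF cap])
    also have "\<dots> \<le> ennreal ((cmod (g y))\<^sup>2) * S"
      unfolding S_def by (intro mult_left_mono SUP_upper y) simp
    finally show "(\<integral>\<^sup>+x. P (x, y) \<partial>\<mu>) \<le> ennreal ((cmod (g y))\<^sup>2) * S" .
  qed
  also have "\<dots> = (\<integral>\<^sup>+y. ennreal ((cmod (g y))\<^sup>2) \<partial>\<sigma>) * S"
    by (rule nn_integral_multc) (use measurable_sigma[OF g_m] in measurable)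
  also have "(\<integral>\<^sup>+y. ennreal ((cmod (g y))\<^sup>2) \<partial>\<sigma>) = ennreal (LINT y|\<sigma>. (cmod (g y))\<^sup>2)"
  proof (rule nn_integral_eq_integral)
    show "integrable \<sigma> (\<lambda>y. (cmod (g y))\<^sup>2)"
      by (rule integrable_sigma_bounded[where B = "K\<^sup>2"])
         (use g_m in measurable, auto intro!: power_mono K)
  qed simp
  finally have main: "(\<integral>\<^sup>+x. ennreal ((cmod (f x))\<^sup>2) \<partial>\<mu>)
      \<le> ennreal A * (ennreal (LINT y|\<sigma>. (cmod (g y))\<^sup>2) * S)"
    by (simp add: mult_left_mono)
  have orth: "(LINT x|\<sigma>. F l x * cnj (F k x)) = 0" if "l \<le> L" "k \<le> L" "l \<noteq> k" for l k
  proof (rule zonal_eigenfunctions_orthogonal[OF h B F[OF that(1)] F[OF that(2)] eig[OF that(1)] eig[OF that(2)]])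
    show "\<kappa> l \<noteq> \<kappa> k" using inj_onD[OF dist, of l k] that by auto
  qed
  have "(LINT y|\<sigma>. (cmod (g y))\<^sup>2) = (\<Sum>l\<le>L. (1 / \<kappa> l)\<^sup>2 * (LINT x|\<sigma>. (cmod (F l x))\<^sup>2))"
    unfolding g_def by (rule integral_norm_square_orthogonal_sum[OF F orth])
  also have "\<dots> \<le> (\<Sum>l\<le>L. (1 / b)\<^sup>2 * (LINT x|\<sigma>. (cmod (F l x))\<^sup>2))"
    by (intro sum_mono mult_right_mono power_mono divide_left_mono)
       (use \<kappa>pos min b in \<open>auto intro: less_imp_le\<close>)
  also have "\<dots> = (1 / b)\<^sup>2 * (LINT x|\<sigma>. (cmod (f x))\<^sup>2)"
    using integral_norm_square_orthogonal_sum[of L F "\<lambda>_. 1", OF F orth]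
    unfolding f_def by (simp add: sum_distrib_left)
  finally have gf: "(LINT y|\<sigma>. (cmod (g y))\<^sup>2) \<le> (LINT x|\<sigma>. (cmod (f x))\<^sup>2) / b\<^sup>2"
    by (simp add: power_divide)
  have "ennreal A * (ennreal (LINT y|\<sigma>. (cmod (g y))\<^sup>2) * S)
      \<le> ennreal A * (ennreal ((LINT x|\<sigma>. (cmod (f x))\<^sup>2) / b\<^sup>2) * S)"
    by (intro mult_left_mono mult_right_mono ennreal_leI gf) auto
  also have "\<dots> = ennreal (A * ((LINT x|\<sigma>. (cmod (f x))\<^sup>2) / b\<^sup>2)) * S"
    using hpos by (subst ennreal_mult') (auto simp: A_def mult.assoc)
  finally show ?thesis
    using main unfolding f_def A_def S_def by (simp add: mult.commute)
qed

section \<open>The Legendre kernel\<close>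

text \<open>
  Up to the factor $2\<pi>$ these integrals are the eigenvalues of the kernel that equals $P_L$ on
  $[\<delta>, 1]$. Their strict monotonicity in the degree gives distinctness, and the last one is the smallest.
\<close>

lemma legendre_kernel_eigenvalues:
  assumes L: "L \<ge> 1" and \<delta>: "legendre_largest_zero L \<le> \<delta>" "\<delta> < 1"
  shows "k < m \<Longrightarrow> m \<le> L \<Longrightarrow>
       integral {\<delta>..1} (\<lambda>t. poly (legendre L) t * poly (legendre m) t)
         < integral {\<delta>..1} (\<lambda>t. poly (legendre L) t * poly (legendre k) t)"
    and "0 < integral {\<delta>..1} (\<lambda>t. poly (legendre L) t * poly (legendre L) t)"
    and "0 \<le> \<delta>"
proof -
  obtain n where n: "L = Suc n" using L by (cases L) auto
  have pos: "poly (legendre k) t > 0" if "k \<le> L" "t > \<delta>" for k t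
    using legendre_largest_zero_interlacing[of n] that \<delta> unfolding n by auto
  show "0 \<le> \<delta>" using legendre_largest_zero_interlacing[of n] \<delta> unfolding n by linarith
  show "integral {\<delta>..1} (\<lambda>t. poly (legendre L) t * poly (legendre m) t)
         < integral {\<delta>..1} (\<lambda>t. poly (legendre L) t * poly (legendre k) t)" if "k < m" "m \<le> L"
  proof (rule integral_less_real)
    fix t assume t: "t \<in> {\<delta><..<1}"
    have "poly (legendre m) t < poly (legendre k) t"
      using t by (intro legendre_strict_decreasing[OF _ _ that]) (auto intro: pos)
    then show "poly (legendre L) t * poly (legendre m) t < poly (legendre L) t * poly (legendre k) t"
      using pos[of L t] t by (intro mult_strict_left_mono) auto
  qed (use \<delta> in \<open>auto intro!: continuous_intros\<close>)
  have "integral {\<delta>..1} (\<lambda>t. 0) < integral {\<delta>..1} (\<lambda>t. poly (legendre L) t * poly (legendre L) t)"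
    by (rule integral_less_real) (use \<delta> pos[of L] in \<open>auto intro!: continuous_intros mult_pos_pos\<close>)
  then show "0 < integral {\<delta>..1} (\<lambda>t. poly (legendre L) t * poly (legendre L) t)" by simp
qed

text \<open>
  The components are given by combinations of powers of null forms on the whole space, which makes them
  continuous there; the functions in the span are only prescribed on the sphere.
\<close>

lemma spherical_polys_eigen_decomposition:
  assumes "f \<in> spherical_polys L"
  shows "\<exists>F :: nat \<Rightarrow> real^3 \<Rightarrow> complex. (\<forall>l. continuous_on UNIV (F l)) \<and>
    (\<forall>x\<in>sphere 0 1. f x = (\<Sum>l\<le>L. F l x)) \<and>
    (\<forall>l h B. h \<in> borel_measurable borel \<longrightarrow> (\<forall>t. \<bar>h t\<bar> \<le> B) \<longrightarrow> (\<forall>x\<in>sphere 0 1.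
      (LINT y|\<sigma>. of_real (h (x \<bullet> y)) * F l y)
        = of_real (LINT y|\<sigma>. h (y$3) * poly (legendre l) (y$3)) * F l x))"
proof -
  obtain d where d: "\<And>x. x \<in> sphere 0 1 \<Longrightarrow>
     f x = (\<Sum>l\<le>L. \<Sum>j<2 * l + 1. d l j * circle_form l j x ^ l)"
    using spherical_polys_eq_sum_null_forms[OF assms] by blast
  define F where "F = (\<lambda>l x. \<Sum>j<2 * l + 1. d l j * circle_form l j x ^ l)"
  have cont: "continuous_on UNIV (circle_form l j)" for l j
    unfolding circle_form_def by (rule continuous_null_form)
  have eig: "(LINT y|\<sigma>. of_real (h (x \<bullet> y)) * F l y)
        = of_real (LINT y|\<sigma>. h (y$3) * poly (legendre l) (y$3)) * F l x"
    if h: "h \<in> borel_measurable borel" and B: "\<And>t. \<bar>h t\<bar> \<le> B" and x: "x \<in> sphere 0 1"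
    for l B x and h :: "real \<Rightarrow> real"
  proof -
    let ?\<kappa> = "complex_of_real (LINT y|\<sigma>. h (y$3) * poly (legendre l) (y$3))"
    have B0: "0 \<le> B" using B[of 0] by linarith
    have int: "integrable \<sigma> (\<lambda>y. of_real (h (x \<bullet> y)) * circle_form l j y ^ l)" for j
    proof -
      have c: "continuous_on UNIV (\<lambda>y. circle_form l j y ^ l)"
        by (intro continuous_intros cont)
      obtain C where C: "\<And>x. x \<in> sphere 0 1 \<Longrightarrow> norm (circle_form l j x ^ l) \<le> C"
        using continuous_bounded_on_sphere[OF c] by metis
      show ?thesis
      proof (rule integrable_sigma_bounded)
        show "(\<lambda>y. of_real (h (x \<bullet> y)) * circle_form l j y ^ l) \<in> borel_measurable borel"
          using h borel_measurable_continuous_onI[OF c] by measurable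
        show "norm (of_real (h (x \<bullet> y)) * circle_form l j y ^ l) \<le> B * C" if "y \<in> sphere 0 1" for y
          unfolding norm_mult using B C[OF that] B0 by (intro mult_mono) auto
      qed
    qed
    have "(LINT y|\<sigma>. of_real (h (x \<bullet> y)) * F l y)
        = (LINT y|\<sigma>. (\<Sum>j<2 * l + 1. d l j * (of_real (h (x \<bullet> y)) * circle_form l j y ^ l)))"
      unfolding F_def sum_distrib_left by (simp only: mult.left_commute)
    also have "\<dots> = (\<Sum>j<2 * l + 1. LINT y|\<sigma>. d l j * (of_real (h (x \<bullet> y)) * circle_form l j y ^ l))"
      by (rule Bochner_Integration.integral_sum) (intro integrable_mult_right int)
    also have "\<dots> = (\<Sum>j<2 * l + 1. d l j * (?\<kappa> * circle_form l j x ^ l))"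
    proof (intro sum.cong refl)
      fix j
      obtain u v where uv: "null_pair u v" and c: "circle_form l j = null_form u v"
        by (rule circle_form_null)
      show "(LINT y|\<sigma>. d l j * (of_real (h (x \<bullet> y)) * circle_form l j y ^ l))
          = d l j * (?\<kappa> * circle_form l j x ^ l)"
        unfolding c by (simp only: integral_mult_right_zero funk_hecke[OF uv h B x])
    qed
    also have "\<dots> = ?\<kappa> * F l x"
      unfolding F_def sum_distrib_left by (simp only: mult.left_commute)
    finally show ?thesis .
  qed
  show ?thesis
  proof (intro exI[of _ F] conjI allI ballI impI)
    show "continuous_on UNIV (F l)" for l
      unfolding F_def by (intro continuous_intros cont)
    show "f x = (\<Sum>l\<le>L. F l x)" if "x \<in> sphere 0 1" for x
      unfolding F_def by (rule d[OF that])
  qed (rule eig; blast)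
qed

lemma spherical_polys_measurable:
  assumes "f \<in> spherical_polys L"
  shows "f \<in> borel_measurable \<sigma>"
proof -
  obtain F where F: "\<And>l. continuous_on UNIV (F l)"
      "\<And>x. x \<in> sphere 0 1 \<Longrightarrow> f x = (\<Sum>l\<le>L. F l x)"
    using spherical_polys_eigen_decomposition[OF assms] by blast
  have "(\<lambda>x. \<Sum>l\<le>L. F l x) \<in> borel_measurable \<sigma>"
    by (intro measurable_sigma borel_measurable_continuous_onI continuous_intros F)
  then show ?thesis
    using F(2) by (subst measurable_cong) auto
qed

lemma sphere_L2_norm_square:
  assumes "f \<in> spherical_polys L"
  shows "(sphere_L2_norm f)\<^sup>2 = (LINT x|\<sigma>. (cmod (f x))\<^sup>2)"
proof -
  have "(LINT x|sphere_measure. (cmod (f x))\<^sup>2) = (LINT x|\<sigma>. (cmod (f x))\<^sup>2)"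
    unfolding sphere_measure_def
    by (rule integral_completion) (use spherical_polys_measurable[OF assms] in measurable)
  moreover have "0 \<le> (LINT x|\<sigma>. (cmod (f x))\<^sup>2)"
    by (rule integral_nonneg_AE) simp
  ultimately show ?thesis
    unfolding sphere_L2_norm_def by simp
qed

lemma large_sieve_inequality:
  assumes \<mu>: "sets \<mu> = sets (restrict_space borel (sphere (0::real^3) 1))" "sigma_finite_measure \<mu>"
    and L: "L \<ge> 1" and \<delta>: "legendre_largest_zero L \<le> \<delta>" "\<delta> < 1"
    and f: "f \<in> spherical_polys L"
  shows "(\<integral>\<^sup>+x. ennreal ((cmod (f x))\<^sup>2) \<partial>\<mu>)
     \<le> ennreal (inverse (2 * pi * integral {\<delta>..1} (\<lambda>t. (poly (legendre L) t)\<^sup>2))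
                         * (sphere_L2_norm f)\<^sup>2)
                * (SUP y\<in>sphere 0 1. emeasure \<mu> (spherical_cap \<delta> y))"
proof -
  note ev = legendre_kernel_eigenvalues[OF L \<delta>]
  obtain F where F: "\<And>l. continuous_on UNIV (F l)"
      "\<And>x. x \<in> sphere 0 1 \<Longrightarrow> f x = (\<Sum>l\<le>L. F l x)"
    and eig: "\<And>l h B x. h \<in> borel_measurable borel \<Longrightarrow> (\<And>t. \<bar>h t\<bar> \<le> B) \<Longrightarrow> x \<in> sphere 0 1 \<Longrightarrow>
      (LINT y|\<sigma>. of_real (h (x \<bullet> y)) * F l y)
        = of_real (LINT y|\<sigma>. h (y$3) * poly (legendre l) (y$3)) * F l x"
    using spherical_polys_eigen_decomposition[OF f] by blast
  \<comment> \<open>The cutoff at \<open>1\<close> makes the kernel bounded on the whole line; heights never exceed \<open>1\<close>.\<close>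
  define h :: "real \<Rightarrow> real" where "h = (\<lambda>t. indicator {\<delta>..1} t * poly (legendre L) t)"
  define \<kappa> where "\<kappa> = (\<lambda>l. 2 * pi * integral {\<delta>..1} (\<lambda>t. poly (legendre L) t * poly (legendre l) t))"
  have h_m: "h \<in> borel_measurable borel"
    unfolding h_def by (intro borel_measurable_times borel_measurable_indicator
        borel_measurable_continuous_onI continuous_intros) simp
  have "compact (poly (legendre L) ` {\<delta>..1})"
    by (intro compact_continuous_image continuous_intros) auto
  then have "bounded (poly (legendre L) ` {\<delta>..1})"
    by (rule compact_imp_bounded)
  then obtain B where B': "B > 0" "\<forall>s\<in>poly (legendre L) ` {\<delta>..1}. norm s \<le> B"
    unfolding bounded_pos by blast
  have B: "\<bar>h t\<bar> \<le> B" for t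
    using B' by (cases "t \<in> {\<delta>..1}") (auto simp: h_def)
  have h_sphere: "h (y$3) = indicator {\<delta>..} (y$3) * poly (legendre L) (y$3)" if "y \<in> sphere 0 1" for y :: "real^3"
    using component_le_norm_cart[of y 3] that by (auto simp: h_def indicator_def)
  have \<kappa>: "(LINT y|\<sigma>. h (y$3) * poly (legendre l) (y$3)) = \<kappa> l" for l
  proof -
    have "(LINT y|\<sigma>. h (y$3) * poly (legendre l) (y$3))
        = (LINT y|\<sigma>. indicator {\<delta>..} (y$3) * (poly (legendre L) (y$3) * poly (legendre l) (y$3)))"
      by (rule Bochner_Integration.integral_cong[OF refl]) (simp add: h_sphere)
    also have "\<dots> = \<kappa> l"
      unfolding \<kappa>_def by (rule integral_sigma_zonal) (use ev(3) \<delta> in \<open>auto intro!: continuous_intros\<close>)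
    finally show ?thesis .
  qed
  have hh: "(LINT y|\<sigma>. (h (y$3))\<^sup>2) = \<kappa> L"
    unfolding \<kappa>[symmetric] 
    by (rule Bochner_Integration.integral_cong[OF refl]) (auto simp: h_sphere indicator_def power2_eq_square)
  have \<kappa>_less: "\<kappa> m < \<kappa> k" if "k < m" "m \<le> L" for k m
    unfolding \<kappa>_def using ev(1)[OF that] by simp
  have \<kappa>L: "\<kappa> L > 0" unfolding \<kappa>_def using ev(2) by simp
  have space: "space \<mu> = sphere 0 1"
    using sets_eq_imp_space_eq[OF \<mu>(1)] by (simp add: space_restrict_space)
  have "(\<integral>\<^sup>+x. ennreal ((cmod (\<Sum>l\<le>L. F l x))\<^sup>2) \<partial>\<mu>)
     \<le> ennreal ((LINT y|\<sigma>. (h (y$3))\<^sup>2) / (\<kappa> L)\<^sup>2 * (LINT x|\<sigma>. (cmod (\<Sum>l\<le>L. F l x))\<^sup>2))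
        * (SUP y\<in>sphere 0 1. emeasure \<mu> (spherical_cap \<delta> y))"
  proof (rule zonal_large_sieve[OF \<mu> h_m B])
    show "h t = 0" if "t < \<delta>" for t using that by (simp add: h_def)
    show "(LINT y|\<sigma>. of_real (h (x \<bullet> y)) * F l y) = of_real (\<kappa> l) * F l x"
      if "x \<in> sphere 0 1" for l x
      using eig[OF h_m B that] by (simp only: \<kappa>)
    show "inj_on \<kappa> {..L}"
      by (rule linorder_inj_onI') (use \<kappa>_less in force)
    show "\<kappa> L \<le> \<kappa> l" if "l \<le> L" for l
      using \<kappa>_less[of l L] that by (cases "l = L") auto
  qed (use F(1) \<kappa>L hh in auto)
  also have "(LINT x|\<sigma>. (cmod (\<Sum>l\<le>L. F l x))\<^sup>2) = (sphere_L2_norm f)\<^sup>2"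
    unfolding sphere_L2_norm_square[OF f]
    by (rule Bochner_Integration.integral_cong[OF refl]) (simp add: F(2))
  also have "(\<integral>\<^sup>+x. ennreal ((cmod (\<Sum>l\<le>L. F l x))\<^sup>2) \<partial>\<mu>) = (\<integral>\<^sup>+x. ennreal ((cmod (f x))\<^sup>2) \<partial>\<mu>)"
    by (rule nn_integral_cong) (simp add: F(2) space)
  also have "(LINT y|\<sigma>. (h (y$3))\<^sup>2) / (\<kappa> L)\<^sup>2
      = inverse (2 * pi * integral {\<delta>..1} (\<lambda>t. (poly (legendre L) t)\<^sup>2))"
    unfolding hh using \<kappa>L by (simp add: \<kappa>_def power2_eq_square field_simps)
  finally show ?thesis .
qed

lemma emeasure_cap:
  assumes "y \<in> sphere 0 1" and "0 \<le> \<delta>" "\<delta> \<le> 1"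
  shows "emeasure \<sigma> (spherical_cap \<delta> y) = ennreal (2 * pi * (1 - \<delta>))"
proof -
  obtain T :: "real^3 \<Rightarrow> real^3" where T: "orthogonal_transformation T"
    and height: "\<And>z. y \<bullet> T z = z$3"
    using rotation_of_pole[OF assms(1)] by blast
  have "measure \<sigma> (spherical_cap \<delta> y) = (LINT x|\<sigma>. indicator {\<delta>..} (y \<bullet> x))"
  proof -
    have "measure \<sigma> (spherical_cap \<delta> y) = (LINT x|\<sigma>. indicator (spherical_cap \<delta> y) x)"
      using cap_in_sets[of \<delta> y] sets.sets_into_space[OF cap_in_sets[of \<delta> y]] by (simp add: Int_absorb2)
    also have "\<dots> = (LINT x|\<sigma>. indicator {\<delta>..} (y \<bullet> x))"
      by (rule Bochner_Integration.integral_cong[OF refl]) (auto simp: spherical_cap_def indicator_def)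
    finally show ?thesis .
  qed
  also have "\<dots> = (LINT x|\<sigma>. indicator {\<delta>..} (y \<bullet> T x))"
    by (rule integral_sigma_rotation[OF T, symmetric]) measurable
  also have "\<dots> = 2 * pi * (1 - \<delta>)"
    unfolding height using integral_sigma_zonal[of "\<lambda>_. 1" \<delta>] assms by simp
  finally show ?thesis
    by (simp add: sigma.emeasure_eq_measure)
qed

text \<open>
  The large sieve for the surface measure restricted to $\<Omega>$. As $\<Omega>$ may be measurable only for the
  completed measure, the restriction is first formed there and then pushed forward to the Borel sets
  by the identity.
\<close>

lemma concentration_le_density:
  assumes \<Omega>: "\<Omega> \<in> sets sphere_measure" and L: "L \<ge> 1" and lz: "legendre_largest_zero L < 1"
  shows "concentration (spherical_polys L) \<Omega> \<le> sieve_constant L * nyquist_density \<Omega> L"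
proof -
  define t where "t = legendre_largest_zero L"
  have t: "0 \<le> t" "t < 1"
    using legendre_kernel_eigenvalues(3)[OF L order_refl lz] lz unfolding t_def by auto
  define J where "J = integral {t..1} (\<lambda>s. (poly (legendre L) s)\<^sup>2)"
  have J: "J > 0"
    using legendre_kernel_eigenvalues(2)[OF L order_refl lz] unfolding t_def J_def power2_eq_square .
  interpret sm: finite_measure sphere_measure
    by (rule finite_measureI) (simp add: emeasure_sphere_measure_sphere)
  have id_m: "(\<lambda>x. x) \<in> sphere_measure \<rightarrow>\<^sub>M \<sigma>"
    unfolding sphere_measure_def by (rule measurable_completion) simp
  have cap_m: "spherical_cap t y \<in> sets sphere_measure" for y
    using cap_in_sets[of t y] unfolding sphere_measure_def by (rule sets_completionI_sets)
  have cap: "measure sphere_measure (spherical_cap t y) = 2 * pi * (1 - t)" if "y \<in> sphere 0 1" for y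
    using emeasure_cap[OF that, of t] t cap_in_sets[of t y]
    by (simp add: measure_def sphere_measure_def emeasure_completion)
  define \<rho> where "\<rho> = nyquist_density \<Omega> L"
  have \<rho>_eq: "\<rho> = (SUP y\<in>sphere 0 1. measure sphere_measure (\<Omega> \<inter> spherical_cap t y) / (2 * pi * (1 - t)))"
    unfolding \<rho>_def nyquist_density_def t_def[symmetric] by (rule SUP_cong) (simp_all add: cap)
  have "bdd_above ((\<lambda>y. measure sphere_measure (\<Omega> \<inter> spherical_cap t y) / (2 * pi * (1 - t))) ` sphere 0 1)"
    using t by (intro bdd_aboveI2[of _ _ "measure sphere_measure (space sphere_measure) / (2 * pi * (1 - t))"]
        divide_right_mono sm.bounded_measure) auto
  then have \<rho>_upper: "measure sphere_measure (\<Omega> \<inter> spherical_cap t y) / (2 * pi * (1 - t)) \<le> \<rho>"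
    if "y \<in> sphere 0 1" for y
    unfolding \<rho>_eq using that by (intro cSUP_upper)
  have \<rho>0: "\<rho> \<ge> 0"
    using order_trans[OF _ \<rho>_upper[of "axis 1 1"]] t by simp
  define \<mu> where "\<mu> = distr (density sphere_measure (indicator \<Omega>)) \<sigma> (\<lambda>x. x)"
  have \<mu>_sets: "sets \<mu> = sets (restrict_space borel (sphere 0 1))"
    unfolding \<mu>_def by simp
  have \<mu>_emeasure: "emeasure \<mu> A = emeasure sphere_measure (\<Omega> \<inter> A)" if "A \<in> sets \<sigma>" for A
  proof -
    have A: "A \<in> sets sphere_measure"
      using that unfolding sphere_measure_def by (rule sets_completionI_sets)
    have "emeasure \<mu> A = emeasure (density sphere_measure (indicator \<Omega>)) A"
      unfolding \<mu>_def using id_m that sets.sets_into_space[OF that]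
      by (subst emeasure_distr) (auto simp: Int_absorb2)
    also have "\<dots> = (\<integral>\<^sup>+x. indicator \<Omega> x * indicator A x \<partial>sphere_measure)"
      using A \<Omega> by (intro emeasure_density) auto
    also have "\<dots> = (\<integral>\<^sup>+x. indicator (\<Omega> \<inter> A) x \<partial>sphere_measure)"
      by (simp only: indicator_inter_arith)
    also have "\<dots> = emeasure sphere_measure (\<Omega> \<inter> A)"
      using A \<Omega> by (intro nn_integral_indicator) auto
    finally show ?thesis .
  qed
  have "finite_measure \<mu>"
  proof (rule finite_measureI)
    have "space \<mu> \<in> sets \<sigma>" using \<mu>_sets sets.top[of \<mu>] by simp
    then show "emeasure \<mu> (space \<mu>) \<noteq> \<infinity>"
      by (simp add: \<mu>_emeasure)
  qed
  then have \<mu>_fin: "sigma_finite_measure \<mu>"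
    by (rule finite_measure.axioms)
  have sup: "(SUP y\<in>sphere 0 1. emeasure \<mu> (spherical_cap t y)) \<le> ennreal (2 * pi * (1 - t) * \<rho>)"
  proof (rule SUP_least)
    fix y :: "real^3" assume y: "y \<in> sphere 0 1"
    have "emeasure \<mu> (spherical_cap t y) = ennreal (measure sphere_measure (\<Omega> \<inter> spherical_cap t y))"
      unfolding \<mu>_emeasure[OF cap_in_sets] by (rule sm.emeasure_eq_measure)
    also have "\<dots> \<le> ennreal (2 * pi * (1 - t) * \<rho>)"
      using \<rho>_upper[OF y] t by (intro ennreal_leI) (simp add: field_simps)
    finally show "emeasure \<mu> (spherical_cap t y) \<le> ennreal (2 * pi * (1 - t) * \<rho>)" .
  qed
  have ratio: "(LINT x:\<Omega>|sphere_measure. (cmod (f x))\<^sup>2) / (LINT x|sphere_measure. (cmod (f x))\<^sup>2)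
      \<le> sieve_constant L * \<rho>" if f: "f \<in> spherical_polys L" for f
  proof -
    define N where "N = (sphere_L2_norm f)\<^sup>2"
    have N: "(LINT x|sphere_measure. (cmod (f x))\<^sup>2) = N"
      unfolding N_def sphere_L2_norm_def by (subst real_sqrt_pow2) (auto intro: integral_nonneg_AE)
    have N0: "N \<ge> 0" unfolding N_def by simp
    have f_sigma: "(\<lambda>x. (cmod (f x))\<^sup>2) \<in> borel_measurable \<sigma>"
      using spherical_polys_measurable[OF f] by measurable
    have f_m: "(\<lambda>x. (cmod (f x))\<^sup>2) \<in> borel_measurable sphere_measure"
      unfolding sphere_measure_def by (rule measurable_completion[OF f_sigma])
    have "(\<integral>\<^sup>+x. ennreal (indicator \<Omega> x * (cmod (f x))\<^sup>2) \<partial>sphere_measure)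
        = (\<integral>\<^sup>+x. ennreal ((cmod (f x))\<^sup>2) \<partial>\<mu>)"
    proof -
      have "(\<integral>\<^sup>+x. ennreal ((cmod (f x))\<^sup>2) \<partial>\<mu>)
          = (\<integral>\<^sup>+x. ennreal ((cmod (f x))\<^sup>2) \<partial>density sphere_measure (indicator \<Omega>))"
        unfolding \<mu>_def using id_m f_sigma by (subst nn_integral_distr) auto
      also have "\<dots> = (\<integral>\<^sup>+x. indicator \<Omega> x * ennreal ((cmod (f x))\<^sup>2) \<partial>sphere_measure)"
        using \<Omega> f_m by (subst nn_integral_density) auto
      finally show ?thesis
        by (simp add: ennreal_mult' ennreal_indicator)
    qed
    also have "\<dots> \<le> ennreal (inverse (2 * pi * J) * N) * (SUP y\<in>sphere 0 1. emeasure \<mu> (spherical_cap t y))"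
      unfolding J_def N_def t_def
      by (rule large_sieve_inequality[OF \<mu>_sets \<mu>_fin L order_refl lz f])
    also have "\<dots> \<le> ennreal (inverse (2 * pi * J) * N) * ennreal (2 * pi * (1 - t) * \<rho>)"
      by (intro mult_left_mono sup) simp
    also have "\<dots> = ennreal (inverse (2 * pi * J) * N * (2 * pi * (1 - t) * \<rho>))"
      using J N0 by (intro ennreal_mult'[symmetric]) auto
    also have "inverse (2 * pi * J) * N * (2 * pi * (1 - t) * \<rho>) = (1 - t) / J * \<rho> * N"
      using J by (simp add: field_simps)
    finally have "(\<integral>\<^sup>+x. ennreal (indicator \<Omega> x * (cmod (f x))\<^sup>2) \<partial>sphere_measure)
        \<le> ennreal ((1 - t) / J * \<rho> * N)" .
    then have "(LINT x|sphere_measure. indicator \<Omega> x * (cmod (f x))\<^sup>2) \<le> (1 - t) / J * \<rho> * N"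
      using \<Omega> f_m J t \<rho>0 N0
      by (subst integral_eq_nn_integral) (auto intro!: enn2real_leI mult_nonneg_nonneg)
    then have "(LINT x:\<Omega>|sphere_measure. (cmod (f x))\<^sup>2) \<le> (1 - t) / J * \<rho> * N"
      by (simp add: set_lebesgue_integral_def)
    then have "(LINT x:\<Omega>|sphere_measure. (cmod (f x))\<^sup>2) / N \<le> (1 - t) / J * \<rho>"
      \<comment> \<open>For \<open>N = 0\<close> the quotient is \<open>0\<close>.\<close>
      using N0 J t \<rho>0 by (cases "N = 0") (auto simp: divide_le_eq)
    then show ?thesis
      unfolding N sieve_constant_def J_def t_def by (simp add: divide_inverse)
  qed
  have "spherical_harmonic 0 0 \<in> spherical_polys L"
  proof -
    have "(\<Sum>m\<in>{- int l..int l}. (if l = 0 then 1 else 0) * spherical_harmonic l m x)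
        = (if l = 0 then spherical_harmonic 0 0 x else 0)" for l x
      by simp
    then have "spherical_harmonic 0 0 x
        = (\<Sum>l\<le>L. \<Sum>m\<in>{- int l..int l}. (if l = 0 then 1 else 0) * spherical_harmonic l m x)" for x
      by simp
    then show ?thesis
      unfolding spherical_polys_def by (intro CollectI exI[of _ "\<lambda>l m. if l = 0 then 1 else 0"]) blast
  qed
  moreover have "spherical_harmonic 0 0 (axis 3 1) \<noteq> 0"
    by (simp add: spherical_harmonic_def assoc_legendre_def)
  moreover have "(axis 3 1 :: real^3) \<in> sphere 0 1"
    by simp
  ultimately have "{f \<in> spherical_polys L. \<exists>x\<in>sphere 0 1. f x \<noteq> 0} \<noteq> {}"
    by blast
  then show ?thesis
    unfolding concentration_def \<rho>_def[symmetric] by (intro cSUP_least ratio) auto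
qed

theorem theorem3p3:
  fixes \<mu> :: "(real^3) measure" and \<Omega> :: "(real^3) set" and L :: nat and \<delta> :: real
  assumes "sets \<mu> = sets (restrict_space borel (sphere 0 1))"
    and "sigma_finite_measure \<mu>"
    and "\<Omega> \<in> sets sphere_measure"
    and "L \<ge> 1"
    and "legendre_largest_zero L \<le> \<delta>" and "\<delta> < 1"
  shows "(\<forall>f\<in>spherical_polys L.
            (\<integral>\<^sup>+x. ennreal ((cmod (f x))\<^sup>2) \<partial>\<mu>)
              \<le> ennreal (inverse (2 * pi * integral {\<delta>..1} (\<lambda>t. (poly (legendre L) t)\<^sup>2))
                         * (sphere_L2_norm f)\<^sup>2)
                * (SUP y\<in>sphere 0 1. emeasure \<mu> (spherical_cap \<delta> y)))
         \<and> concentration (spherical_polys L) \<Omega> \<le> sieve_constant L * nyquist_density \<Omega> L"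
proof (intro conjI ballI)
  fix f assume "f \<in> spherical_polys L"
  then show "(\<integral>\<^sup>+x. ennreal ((cmod (f x))\<^sup>2) \<partial>\<mu>)
      \<le> ennreal (inverse (2 * pi * integral {\<delta>..1} (\<lambda>t. (poly (legendre L) t)\<^sup>2))
                 * (sphere_L2_norm f)\<^sup>2)
        * (SUP y\<in>sphere 0 1. emeasure \<mu> (spherical_cap \<delta> y))"
    by (rule large_sieve_inequality[OF assms(1,2,4-6)])
next
  show "concentration (spherical_polys L) \<Omega> \<le> sieve_constant L * nyquist_density \<Omega> L"
    using assms by (intro concentration_le_density) auto
qed

end
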